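(* Let $p$ be an odd prime and let $G$ be a $4$-generated group of nilpotency class at most $2$ and exponent $p$. Then $G$ satisfies one and only one of the following: (i) $G$ is cyclic and nontrivial; (ii) $G$ is extra-special of order $p^5$ and exponent $p$; (iii) $G$ is capable.
   Context: A group $G$ is capable if there exists a group $K$ such that $G\cong K/Z(K)$, where $Z(K)$ is the center of $K$. A group is called $k$-generated if it can be generated by $k$ elements (it may need fewer). *)

theory Defs
  imports "HOL-Algebra.Algebra" "HOL-Library.Nat_Bijection" "HOL-Computational_Algebra.Primes"
begin

definition center :: "('a, 'b) monoid_scheme \<Rightarrow> 'a set" where
  "center G = {z \<in> carrier G. \<forall>x\<in>carrier G. z \<otimes>\<^bsub>G\<^esub> x = x \<otimes>\<^bsub>G\<^esub> z}"

definition generated_by_at_most :: "('a, 'b) monoid_scheme \<Rightarrow> nat \<Rightarrow> bool" where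
  "generated_by_at_most G k \<longleftrightarrow>
     (\<exists>S. S \<subseteq> carrier G \<and> finite S \<and> card S \<le> k \<and> generate G S = carrier G)"

text \<open>The index is shifted: \<open>lower_central G n\<close> is the term usually written with subscript
  \<open>n + 1\<close>.  In particular \<open>lower_central G 1\<close> is the derived subgroup.\<close>

primrec lower_central :: "('a, 'b) monoid_scheme \<Rightarrow> nat \<Rightarrow> 'a set" where
  "lower_central G 0 = carrier G"
| "lower_central G (Suc n) = generate G
     {x \<otimes>\<^bsub>G\<^esub> y \<otimes>\<^bsub>G\<^esub> inv\<^bsub>G\<^esub> x \<otimes>\<^bsub>G\<^esub> inv\<^bsub>G\<^esub> y | x y. x \<in> lower_central G n \<and> y \<in> carrier G}"

definition nilpotency_class_at_most :: "('a, 'b) monoid_scheme \<Rightarrow> nat \<Rightarrow> bool" where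
  "nilpotency_class_at_most G c \<longleftrightarrow> lower_central G c = {\<one>\<^bsub>G\<^esub>}"

text \<open>As is customary for classes of groups of exponent \<open>p\<close>, the trivial group is included.  For a
  prime \<open>p\<close> and a nontrivial group this says that the exponent is exactly \<open>p\<close>.\<close>

definition of_exponent :: "('a, 'b) monoid_scheme \<Rightarrow> nat \<Rightarrow> bool" where
  "of_exponent G p \<longleftrightarrow> (\<forall>x\<in>carrier G. x [^]\<^bsub>G\<^esub> p = \<one>\<^bsub>G\<^esub>)"

text \<open>\<open>extraspecial\<close> is meant for prime \<open>p\<close> and finite groups; the last three conditions say that the
  central quotient is a nontrivial elementary abelian \<open>p\<close>-group.\<close>

definition extraspecial :: "nat \<Rightarrow> ('a, 'b) monoid_scheme \<Rightarrow> bool" where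
  "extraspecial p G \<longleftrightarrow>
     group G \<and> (\<exists>n. order G = p ^ n) \<and> card (center G) = p \<and>
     comm_group (G Mod center G) \<and> of_exponent (G Mod center G) p \<and>
     \<not> trivial_group (G Mod center G)"

text \<open>HOL cannot quantify over the type of the elements of \<open>K\<close> inside a definition.  Taking \<open>K\<close> over
  \<open>'a list\<close>, a type of cardinality \<open>max \<bar>'a\<bar> \<aleph>\<^sub>0\<close>, is no restriction: see \<open>capableI\<close> below.\<close>

definition capable :: "('a, 'b) monoid_scheme \<Rightarrow> bool" where
  "capable G \<longleftrightarrow> (\<exists>K :: 'a list monoid. group K \<and> G \<cong> K Mod center K)"

lemma ex_inj_words: "\<exists>e :: ('a \<times> bool) list \<Rightarrow> 'a list. inj e"
proof -
  define c where "c w = prod_encode (length w, list_encode (map (of_bool \<circ> snd) w))"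
    for w :: "('a \<times> bool) list"
  define e where "e w = map fst w @ replicate (c w - length w) undefined"
    for w :: "('a \<times> bool) list"
  have len: "length (e w) = c w" for w
    unfolding e_def c_def using le_prod_encode_1[of "length w"] by simp
  have "w = w'" if "e w = e w'" for w w'
  proof -
    have cw: "c w = c w'" using that len by metis
    then have l: "length w = length w'"
      and b: "map (of_bool \<circ> snd) w = (map (of_bool \<circ> snd) w' :: nat list)"
      unfolding c_def by (auto dest: inj_prod_encode[THEN injD] inj_list_encode[THEN injD])
    have "map fst w = take (length w) (e w)" by (simp add: e_def)
    also have "\<dots> = map fst w'" unfolding that l by (simp add: e_def)
    finally have a: "map fst w = map fst w'" .
    have "map snd w = map snd w'"
    proof (rule nth_equalityI)
      fix i assume "i < length (map snd w)"
      then have i: "i < length w" by simp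
      from b have "map (of_bool \<circ> snd) w ! i = (map (of_bool \<circ> snd) w' ! i :: nat)" by simp
      then show "map snd w ! i = map snd w' ! i" using i l by (simp add: of_bool_eq_iff)
    qed (use l in simp)
    then show ?thesis using a by (metis zip_map_fst_snd)
  qed
  then have "inj e" by (rule injI)
  then show ?thesis by blast
qed

lemma isomorphic_Mod_center:
  assumes "group K" "group G" "f \<in> hom K G" "f ` carrier K = carrier G"
    and "kernel K G f = center K"
  shows "G \<cong> K Mod center K"
proof -
  interpret group_hom K G f using assms by (simp add: group_hom_def group_hom_axioms_def)
  have iso: "K Mod center K \<cong> G" using FactGroup_iso assms(4,5) by simp
  have "group (K Mod center K)"
    using normal.factorgroup_is_group[OF normal_kernel] assms(5) by simp
  then show ?thesis using group.iso_sym iso by blast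
qed

lemma center_normal:
  assumes "group K" shows "center K \<lhd> K"
proof -
  interpret group K by fact
  have "subgroup (center K) K"
  proof
    fix x assume x: "x \<in> center K"
    have "inv\<^bsub>K\<^esub> x \<otimes>\<^bsub>K\<^esub> y = y \<otimes>\<^bsub>K\<^esub> inv\<^bsub>K\<^esub> x" if "y \<in> carrier K" for y
    proof -
      have x': "x \<in> carrier K" "x \<otimes>\<^bsub>K\<^esub> y = y \<otimes>\<^bsub>K\<^esub> x" using x that by (auto simp: center_def)
      have "inv\<^bsub>K\<^esub> x \<otimes>\<^bsub>K\<^esub> y = inv\<^bsub>K\<^esub> x \<otimes>\<^bsub>K\<^esub> (y \<otimes>\<^bsub>K\<^esub> x) \<otimes>\<^bsub>K\<^esub> inv\<^bsub>K\<^esub> x" using x'(1) that by (simp add: m_assoc)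
      also have "\<dots> = inv\<^bsub>K\<^esub> x \<otimes>\<^bsub>K\<^esub> (x \<otimes>\<^bsub>K\<^esub> y) \<otimes>\<^bsub>K\<^esub> inv\<^bsub>K\<^esub> x" using x'(2) by simp
      also have "\<dots> = y \<otimes>\<^bsub>K\<^esub> inv\<^bsub>K\<^esub> x" using x'(1) that by (simp add: m_assoc[symmetric])
      finally show ?thesis .
    qed
    then show "inv\<^bsub>K\<^esub> x \<in> center K" using x by (simp add: center_def)
  next
    fix x y assume "x \<in> center K" "y \<in> center K"
    then have xy: "x \<in> carrier K" "y \<in> carrier K"
        "\<And>u. u \<in> carrier K \<Longrightarrow> x \<otimes>\<^bsub>K\<^esub> u = u \<otimes>\<^bsub>K\<^esub> x"
        "\<And>u. u \<in> carrier K \<Longrightarrow> y \<otimes>\<^bsub>K\<^esub> u = u \<otimes>\<^bsub>K\<^esub> y"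
      by (auto simp: center_def)
    have "x \<otimes>\<^bsub>K\<^esub> y \<otimes>\<^bsub>K\<^esub> u = u \<otimes>\<^bsub>K\<^esub> (x \<otimes>\<^bsub>K\<^esub> y)" if u: "u \<in> carrier K" for u
    proof -
      have "x \<otimes>\<^bsub>K\<^esub> y \<otimes>\<^bsub>K\<^esub> u = x \<otimes>\<^bsub>K\<^esub> (y \<otimes>\<^bsub>K\<^esub> u)" using xy(1,2) u by (rule m_assoc)
      also have "\<dots> = x \<otimes>\<^bsub>K\<^esub> (u \<otimes>\<^bsub>K\<^esub> y)" using xy(4)[OF u] by simp
      also have "\<dots> = x \<otimes>\<^bsub>K\<^esub> u \<otimes>\<^bsub>K\<^esub> y" using m_assoc[OF xy(1) u xy(2)] by simp
      also have "\<dots> = u \<otimes>\<^bsub>K\<^esub> x \<otimes>\<^bsub>K\<^esub> y" using xy(3)[OF u] by simp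
      also have "\<dots> = u \<otimes>\<^bsub>K\<^esub> (x \<otimes>\<^bsub>K\<^esub> y)" using u xy(1,2) by (rule m_assoc)
      finally show ?thesis .
    qed
    then show "x \<otimes>\<^bsub>K\<^esub> y \<in> center K" using xy(1,2) by (simp add: center_def)
  qed (auto simp: center_def)
  moreover have "x \<otimes>\<^bsub>K\<^esub> h \<otimes>\<^bsub>K\<^esub> inv\<^bsub>K\<^esub> x \<in> center K" if "x \<in> carrier K" "h \<in> center K" for x h
  proof -
    have "x \<otimes>\<^bsub>K\<^esub> h \<otimes>\<^bsub>K\<^esub> inv\<^bsub>K\<^esub> x = h" 
    proof -
      have "h \<in> carrier K" "x \<otimes>\<^bsub>K\<^esub> h = h \<otimes>\<^bsub>K\<^esub> x" using that by (auto simp: center_def)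
      then show ?thesis using that(1) by (simp add: m_assoc)
    qed
    then show ?thesis using that by simp
  qed
  ultimately show ?thesis by (simp add: normal_inv_iff)
qed

lemma capableI:
  fixes G :: "('a, 'b) monoid_scheme" and K :: "('c, 'd) monoid_scheme"
  assumes G: "group G" and K: "group K" and GK: "G \<cong> K Mod center K"
  shows "capable G"
proof -
  interpret K: group K by fact
  interpret G: group G by fact
  interpret Z: normal "center K" K using center_normal[OF K] .
  have "K Mod center K \<cong> G" using G.iso_sym[OF GK] .
  then obtain \<phi> where \<phi>: "\<phi> \<in> iso (K Mod center K) G" by (auto simp: is_iso_def)
  then have \<phi>h: "\<phi> \<in> hom (K Mod center K) G"
    and \<phi>b: "bij_betw \<phi> (carrier (K Mod center K)) (carrier G)" by (auto simp: iso_def)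
  define f where "f x = \<phi> (center K #>\<^bsub>K\<^esub> x)" for x
  have fh: "f \<in> hom K G"
    using hom_compose[OF Z.r_coset_hom_Mod \<phi>h] unfolding f_def comp_def .
  interpret f: group_hom K G f using fh by unfold_locales
  have surj: "f ` carrier K = carrier G"
    using \<phi>b by (auto simp: bij_betw_def f_def carrier_FactGroup image_image)
  have ker: "kernel K G f = center K"
  proof -
    have "f x = \<one>\<^bsub>G\<^esub> \<longleftrightarrow> x \<in> center K" if x: "x \<in> carrier K" for x
    proof -
      have one: "\<phi> (center K) = \<one>\<^bsub>G\<^esub>"
        using hom_one[OF \<phi>h Z.factorgroup_is_group G] by simp
      have "center K #>\<^bsub>K\<^esub> x \<in> carrier (K Mod center K)"
        "center K \<in> carrier (K Mod center K)"
        using x Z.factorgroup_is_group[THEN group.is_monoid, THEN monoid.one_closed]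
        by (auto simp: carrier_FactGroup)
      then have "f x = \<one>\<^bsub>G\<^esub> \<longleftrightarrow> center K #>\<^bsub>K\<^esub> x = center K"
        using \<phi>b one unfolding f_def bij_betw_def by (metis inj_on_eq_iff)
      also have "\<dots> \<longleftrightarrow> x \<in> center K"
        using K.coset_join1[OF _ x Z.subgroup_axioms] K.coset_join2[OF x Z.subgroup_axioms]
          Z.subset by blast
      finally show ?thesis .
    qed
    then show ?thesis using Z.subset by (auto simp: kernel_def)
  qed
  define t where "t g = (if g \<in> carrier G then SOME x. x \<in> carrier K \<and> f x = g else \<one>\<^bsub>K\<^esub>)" for g
  have t1: "t g \<in> carrier K \<and> f (t g) = g" if "g \<in> carrier G" for g
  proof -
    have "\<exists>x. x \<in> carrier K \<and> f x = g" using that surj by (metis imageE)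
    from someI_ex[OF this] show ?thesis using that by (simp add: t_def)
  qed
  have tc: "t g \<in> carrier K" for g using t1 by (cases "g \<in> carrier G") (auto simp: t_def)
  define s where "s a = (if snd a then t (fst a) else inv\<^bsub>K\<^esub> (t (fst a)))" for a :: "'a \<times> bool"
  have sc: "s a \<in> carrier K" for a using tc by (simp add: s_def)
  define wd where "wd w = foldr (\<lambda>a x. s a \<otimes>\<^bsub>K\<^esub> x) w \<one>\<^bsub>K\<^esub>" for w
  have wd_simps: "wd [] = \<one>\<^bsub>K\<^esub>" "\<And>a w. wd (a # w) = s a \<otimes>\<^bsub>K\<^esub> wd w" by (simp_all add: wd_def)
  have wc: "wd w \<in> carrier K" for w by (induct w) (auto simp: wd_simps sc)
  have wapp: "wd (u @ v) = wd u \<otimes>\<^bsub>K\<^esub> wd v" for u v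
    by (induct u) (auto simp: wd_simps sc wc K.m_assoc)
  have sinv: "inv\<^bsub>K\<^esub> (s a) = s (fst a, \<not> snd a)" for a using tc by (simp add: s_def)
  have winv: "\<exists>v. inv\<^bsub>K\<^esub> (wd u) = wd v" for u
  proof (induct u)
    case Nil
    have "inv\<^bsub>K\<^esub> (wd []) = wd []" by (simp add: wd_simps)
    then show ?case by (rule exI)
  next
    case (Cons a u)
    then obtain v where v: "inv\<^bsub>K\<^esub> (wd u) = wd v" by (rule exE)
    have "inv\<^bsub>K\<^esub> (wd (a # u)) = wd (v @ [(fst a, \<not> snd a)])"
      by (simp add: wd_simps K.inv_mult_group sc wc v sinv wapp)
    then show ?case by (rule exI)
  qed
  define H where "H = range wd"
  have H: "subgroup H K"
  proof
    fix x y assume "x \<in> H" "y \<in> H"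
    then show "x \<otimes>\<^bsub>K\<^esub> y \<in> H" unfolding H_def by (auto simp: wapp[symmetric])
  next
    show "\<one>\<^bsub>K\<^esub> \<in> H" unfolding H_def by (simp add: wd_simps(1)[symmetric])
  next
    fix x assume "x \<in> H"
    then obtain u where "x = wd u" by (auto simp: H_def)
    moreover obtain v where "inv\<^bsub>K\<^esub> (wd u) = wd v" using winv[of u] by (rule exE)
    ultimately show "inv\<^bsub>K\<^esub> x \<in> H" by (simp add: H_def)
  qed (use wc in \<open>auto simp: H_def\<close>)
  interpret H: subgroup H K by fact
  have tH: "t g \<in> H" for g
  proof -
    have "t g = wd [(g, True)]" using tc by (simp add: wd_simps s_def)
    then show ?thesis by (simp add: H_def)
  qed
  have cH: "x \<in> center K" if x: "x \<in> H" and cm: "\<forall>y\<in>H. x \<otimes>\<^bsub>K\<^esub> y = y \<otimes>\<^bsub>K\<^esub> x" for x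
  proof -
    have xc: "x \<in> carrier K" using x by simp
    have "x \<otimes>\<^bsub>K\<^esub> y = y \<otimes>\<^bsub>K\<^esub> x" if y: "y \<in> carrier K" for y
    proof -
      define u where "u = t (f y)"
      define z where "z = y \<otimes>\<^bsub>K\<^esub> inv\<^bsub>K\<^esub> u"
      have u: "u \<in> carrier K" "f u = f y" "u \<in> H" using t1[of "f y"] y tH by (auto simp: u_def)
      have zc: "z \<in> carrier K" using y u by (simp add: z_def)
      have "f z = f y \<otimes>\<^bsub>G\<^esub> inv\<^bsub>G\<^esub> (f y)" unfolding z_def using y u by simp
      then have "f z = \<one>\<^bsub>G\<^esub>" using y by simp
      then have "z \<in> center K" using zc unfolding ker[symmetric] kernel_def by simp
      then have zx: "z \<otimes>\<^bsub>K\<^esub> x = x \<otimes>\<^bsub>K\<^esub> z" using xc unfolding center_def by blast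
      have yz: "y = z \<otimes>\<^bsub>K\<^esub> u" using y u(1) unfolding z_def by (simp add: K.m_assoc)
      have "x \<otimes>\<^bsub>K\<^esub> y = x \<otimes>\<^bsub>K\<^esub> z \<otimes>\<^bsub>K\<^esub> u" unfolding yz using xc zc u(1) by (rule K.m_assoc[symmetric])
      also have "\<dots> = z \<otimes>\<^bsub>K\<^esub> x \<otimes>\<^bsub>K\<^esub> u" using zx by simp
      also have "\<dots> = z \<otimes>\<^bsub>K\<^esub> (x \<otimes>\<^bsub>K\<^esub> u)" using zc xc u(1) by (rule K.m_assoc)
      also have "\<dots> = z \<otimes>\<^bsub>K\<^esub> (u \<otimes>\<^bsub>K\<^esub> x)" using bspec[OF cm u(3)] by simp
      also have "\<dots> = y \<otimes>\<^bsub>K\<^esub> x" unfolding yz using zc u(1) xc by (rule K.m_assoc[symmetric])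
      finally show ?thesis .
    qed
    then show ?thesis using xc unfolding center_def by blast
  qed
  obtain e0 :: "('a \<times> bool) list \<Rightarrow> 'a list" where e0: "inj e0" using ex_inj_words by blast
  define e where "e x = e0 (inv_into UNIV wd x)" for x
  have einj: "inj_on e H"
  proof (rule inj_onI)
    fix x y assume xy: "x \<in> H" "y \<in> H" and "e x = e y"
    then have "inv_into UNIV wd x = inv_into UNIV wd y" unfolding e_def by (simp add: injD[OF e0])
    then have "wd (inv_into UNIV wd x) = wd (inv_into UNIV wd y)" by (rule arg_cong)
    then show "x = y" using xy unfolding H_def by (simp only: f_inv_into_f)
  qed
  define d where "d = inv_into H e"
  have de: "d (e x) = x" if "x \<in> H" for x using that einj by (simp add: d_def)
  define L :: "'a list monoid" where
    "L = \<lparr>carrier = e ` H, monoid.mult = (\<lambda>x y. e (d x \<otimes>\<^bsub>K\<^esub> d y)), one = e \<one>\<^bsub>K\<^esub>\<rparr>"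
  have L: "group L"
  proof (rule groupI)
    fix x assume "x \<in> carrier L"
    then obtain u where u: "u \<in> H" "x = e u" by (auto simp: L_def)
    then show "\<exists>y\<in>carrier L. y \<otimes>\<^bsub>L\<^esub> x = \<one>\<^bsub>L\<^esub>"
      by (intro bexI[of _ "e (inv\<^bsub>K\<^esub> u)"]) (auto simp: L_def de)
  qed (auto simp: L_def de K.m_assoc)
  define h where "h x = f (d x)" for x
  have hh: "h \<in> hom L G" by (rule homI) (auto simp: L_def h_def de)
  have hs: "h ` carrier L = carrier G"
  proof -
    have "h ` carrier L = f ` H" by (force simp: L_def h_def de image_image)
    also have "\<dots> = carrier G"
    proof
      show "carrier G \<subseteq> f ` H" using t1 tH by (metis image_eqI subsetI)
    qed auto
    finally show ?thesis .
  qed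
  have "center L = e ` (H \<inter> center K)"
  proof -
    have "e u \<in> center L \<longleftrightarrow> u \<in> center K" if u: "u \<in> H" for u
    proof -
      have "e u \<in> center L \<longleftrightarrow> (\<forall>y\<in>H. e (u \<otimes>\<^bsub>K\<^esub> y) = e (y \<otimes>\<^bsub>K\<^esub> u))"
        using u by (auto simp: center_def L_def de)
      also have "\<dots> \<longleftrightarrow> (\<forall>y\<in>H. u \<otimes>\<^bsub>K\<^esub> y = y \<otimes>\<^bsub>K\<^esub> u)"
        using u einj by (auto simp: inj_on_eq_iff)
      also have "\<dots> \<longleftrightarrow> u \<in> center K"
      proof
        assume "u \<in> center K"
        then have "\<forall>y\<in>carrier K. u \<otimes>\<^bsub>K\<^esub> y = y \<otimes>\<^bsub>K\<^esub> u" unfolding center_def by blast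
        then show "\<forall>y\<in>H. u \<otimes>\<^bsub>K\<^esub> y = y \<otimes>\<^bsub>K\<^esub> u" using H.subset by blast
      qed (rule cH[OF u])
      finally show ?thesis .
    qed
    moreover have "center L \<subseteq> e ` H" by (auto simp: center_def L_def)
    ultimately show ?thesis by auto
  qed
  also have "\<dots> = kernel L G h"
    unfolding ker[symmetric] by (auto simp: kernel_def L_def h_def de)
  finally have "G \<cong> L Mod center L" using isomorphic_Mod_center[OF L G hh hs] by simp
  then show ?thesis using L by (auto simp: capable_def)
qed

end

theory Submission
  imports Defs "HOL-Number_Theory.Cong"
begin

text \<open>
  Let \<open>Z\<close> be the center of \<open>G\<close>.  By taking fibre products of central extensions, \<open>G\<close> is capable once
  every \<open>z \<noteq> \<one>\<close> in \<open>Z\<close> has noncentral lifts in some central extension of \<open>G\<close> by \<open>\<int>/p\<close>.  Outside the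
  derived subgroup a product of two characters is a suitable cocycle unless \<open>G\<close> is cyclic.  For \<open>z\<close> in
  the derived subgroup, a linear functional \<open>\<lambda>\<close> with \<open>\<lambda> z \<noteq> 0\<close> gives an alternating form
  \<open>\<omega> x y = \<lambda> [x, y] / 2\<close> on \<open>V = G / Z\<close>, and a tensor \<open>\<Sum> l\<^sub>i \<otimes> \<omega>\<^sub>i\<close> with \<open>\<Sum> l\<^sub>i \<and> \<omega>\<^sub>i = 0\<close>
  yields a cocycle for which \<open>z\<close> pairs with \<open>g\<close> to \<open>\<Sum> l\<^sub>i g \<cdot> \<lambda>\<^sub>i z\<close>, up to sign and a factor 2.
  Since \<open>dim V \<le> 4\<close>, the map \<open>l \<mapsto> l \<and> \<omega>\<close> from \<open>V\<^sup>*\<close> to the alternating trilinear forms is either not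
  injective, which gives \<open>l \<otimes> \<omega>\<close>, or \<open>dim V = 4\<close> and it is bijective.  In the latter case any form
  \<open>\<omega>' \<noteq> 0\<close> from a functional with \<open>\<lambda>' z = 0\<close> gives \<open>l \<otimes> \<omega> - l' \<otimes> \<omega>'\<close>; if there is none, then \<open>Z\<close> is
  generated by \<open>z\<close> and \<open>G\<close> is extraspecial of order \<open>p\<^sup>5\<close>.

  Conversely, let \<open>K\<close> have such an extraspecial central quotient \<open>G\<close>, and let \<open>t\<close> be a lift of a
  central element of \<open>G\<close>.  For a lift \<open>w\<close> of a noncentral element, counting yields a noncentral element
  commuting with the image of \<open>w\<close> and with an element that does not; the Hall--Witt identity,
  applied twice, shows that \<open>w\<close> commutes with \<open>t\<close>.  Hence \<open>t\<close> is central, a contradiction.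
\<close>

section \<open>Capability from cocycles\<close>

text \<open>Cocycles with values in the integers modulo \<open>m\<close>, for the trivial action.
  Integer-valued functions and congruences leave room for explicit polynomial formulas.\<close>

definition normalized_cocycle :: "('a, 'b) monoid_scheme \<Rightarrow> int \<Rightarrow> ('a \<Rightarrow> 'a \<Rightarrow> int) \<Rightarrow> bool" where
  "normalized_cocycle G m f \<longleftrightarrow>
     (\<forall>g\<in>carrier G. [f g \<one>\<^bsub>G\<^esub> = 0] (mod m) \<and> [f \<one>\<^bsub>G\<^esub> g = 0] (mod m)) \<and>
     (\<forall>g\<in>carrier G. \<forall>h\<in>carrier G. \<forall>k\<in>carrier G.
        [f g h + f (g \<otimes>\<^bsub>G\<^esub> h) k = f h k + f g (h \<otimes>\<^bsub>G\<^esub> k)] (mod m))"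

lemma (in group) hom_center_subset:
  assumes "f \<in> hom K G" "f ` carrier K = carrier G" "x \<in> center K"
  shows "f x \<in> center G"
proof -
  have "f x \<otimes> y = y \<otimes> f x" if "y \<in> carrier G" for y
  proof -
    from that assms(2) obtain k where k: "k \<in> carrier K" "y = f k" by blast
    have x: "x \<in> carrier K" "x \<otimes>\<^bsub>K\<^esub> k = k \<otimes>\<^bsub>K\<^esub> x" using assms(3) k by (auto simp: center_def)
    then show ?thesis using hom_mult[OF assms(1) x(1) k(1)] hom_mult[OF assms(1) k(1) x(1)] k by simp
  qed
  then show ?thesis using assms by (auto simp: center_def hom_def)
qed

text \<open>The group below is the fibre product over \<open>G\<close> of the central extensions given by the
  cocycles, so an element over \<open>z \<noteq> \<one>\<close> is already noncentral in the factor belonging to \<open>z\<close>.\<close>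

lemma capable_if_cocycles:
  fixes G :: "('a, 'b) monoid_scheme" (structure) and m :: int
  assumes G: "group G" and m: "m > 0"
    and ex: "\<And>z. z \<in> center G \<Longrightarrow> z \<noteq> \<one>\<^bsub>G\<^esub> \<Longrightarrow>
      \<exists>f. normalized_cocycle G m f \<and> (\<exists>h\<in>carrier G. \<not> [f z h = f h z] (mod m))"
  shows "capable G"
proof -
  interpret group G by fact
  \<comment> \<open>A cocycle is chosen for every element of the type, the zero cocycle where
    nothing has to be detected. The kernel of the extension can then consist of functions on the
    whole type.\<close>
  have "\<forall>z. \<exists>f. normalized_cocycle G m f \<and>
      (z \<in> center G \<longrightarrow> z \<noteq> \<one>\<^bsub>G\<^esub> \<longrightarrow> (\<exists>h\<in>carrier G. \<not> [f z h = f h z] (mod m)))"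
  proof
    fix z
    have triv: "normalized_cocycle G m (\<lambda>g h. 0)" by (simp add: normalized_cocycle_def)
    show "\<exists>f. normalized_cocycle G m f \<and>
      (z \<in> center G \<longrightarrow> z \<noteq> \<one>\<^bsub>G\<^esub> \<longrightarrow> (\<exists>h\<in>carrier G. \<not> [f z h = f h z] (mod m)))"
    proof (cases "z \<in> center G \<and> z \<noteq> \<one>\<^bsub>G\<^esub>")
      case True
      then show ?thesis using ex[of z] by auto
    next
      case False
      then show ?thesis using triv by auto
    qed
  qed
  then obtain F where F: "\<And>z. normalized_cocycle G m (F z)"
    and Fz: "\<And>z. z \<in> center G \<Longrightarrow> z \<noteq> \<one>\<^bsub>G\<^esub> \<Longrightarrow> \<exists>h\<in>carrier G. \<not> [F z z h = F z h z] (mod m)"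
    by metis
  have F1: "F z g \<one>\<^bsub>G\<^esub> mod m = 0" "F z \<one>\<^bsub>G\<^esub> g mod m = 0" if "g \<in> carrier G" for z g
    using F[of z] that by (auto simp: normalized_cocycle_def cong_def)
  have Fc: "(F z g h + F z (g \<otimes> h) k) mod m = (F z h k + F z g (h \<otimes> k)) mod m"
    if "g \<in> carrier G" "h \<in> carrier G" "k \<in> carrier G" for z g h k
    using F[of z] that by (auto simp: normalized_cocycle_def cong_def)
  define K :: "('a \<times> ('a \<Rightarrow> int)) monoid" where
    "K = \<lparr>carrier = carrier G \<times> (UNIV \<rightarrow> {0..<m}),
          monoid.mult = (\<lambda>(g, u) (h, v). (g \<otimes> h, \<lambda>z. (u z + v z + F z g h) mod m)),
          one = (\<one>, \<lambda>z. 0)\<rparr>"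
  have K: "group K"
  proof (rule groupI)
    fix x y z assume "x \<in> carrier K" "y \<in> carrier K" "z \<in> carrier K"
    then obtain g u h v k w where x: "x = (g, u)" "g \<in> carrier G" and y: "y = (h, v)" "h \<in> carrier G"
      and z: "z = (k, w)" "k \<in> carrier G" by (auto simp: K_def)
    have "(u t + v t + F t g h + w t + F t (g \<otimes> h) k) mod m
        = (u t + (v t + w t + F t h k) + F t g (h \<otimes> k)) mod m" for t
    proof -
      have "(u t + v t + F t g h + w t + F t (g \<otimes> h) k) mod m
        = (u t + v t + w t + (F t g h + F t (g \<otimes> h) k)) mod m" by (simp add: algebra_simps)
      also have "\<dots> = (u t + v t + w t + (F t h k + F t g (h \<otimes> k))) mod m"
        by (metis Fc[OF x(2) y(2) z(2)] mod_add_right_eq)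
      finally show ?thesis by (simp add: algebra_simps)
    qed
    moreover have "(a + b mod m + c) mod m = (a + b + c) mod m"
        "(b mod m + a + c) mod m = (b + a + c) mod m" for a b c :: int
      by (metis mod_add_left_eq mod_add_right_eq)+
    ultimately have "((u t + v t + F t g h) mod m + w t + F t (g \<otimes> h) k) mod m
        = (u t + (v t + w t + F t h k) mod m + F t g (h \<otimes> k)) mod m" for t
      by (simp only:)
    then show "x \<otimes>\<^bsub>K\<^esub> y \<otimes>\<^bsub>K\<^esub> z = x \<otimes>\<^bsub>K\<^esub> (y \<otimes>\<^bsub>K\<^esub> z)"
      using x y z by (simp add: K_def m_assoc)
  next
    fix x assume "x \<in> carrier K"
    then obtain g u where x: "x = (g, u)" "g \<in> carrier G" and u: "\<And>t. u t \<in> {0..<m}"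
      by (cases x) (auto simp: K_def Pi_iff)
    have "(u t + F t \<one> g) mod m = u t" for t
      using F1(2)[OF x(2), of t] u[of t] by (simp add: mod_add_eq[symmetric])
    then show "\<one>\<^bsub>K\<^esub> \<otimes>\<^bsub>K\<^esub> x = x" using x by (simp add: K_def)
    show "\<exists>y\<in>carrier K. y \<otimes>\<^bsub>K\<^esub> x = \<one>\<^bsub>K\<^esub>"
    proof (intro bexI)
      let ?y = "(inv g, \<lambda>t. (- u t - F t (inv g) g) mod m)"
      show "?y \<in> carrier K" using x m by (simp add: K_def)
      have "((- u t - F t (inv g) g) mod m + u t + F t (inv g) g) mod m = 0" for t
        using mod_add_left_eq[of "- u t - F t (inv g) g" m "u t + F t (inv g) g"]
        by (simp add: add.assoc)
      then show "?y \<otimes>\<^bsub>K\<^esub> x = \<one>\<^bsub>K\<^esub>" using x by (simp add: K_def)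
    qed
  qed (use m in \<open>auto simp: K_def\<close>)
  have hom: "fst \<in> hom K G" by (rule homI) (auto simp: K_def)
  have "(\<one>, \<lambda>z. 0) \<in> carrier K" using m by (simp add: K_def)
  have surj: "fst ` carrier K = carrier G"
  proof
    show "carrier G \<subseteq> fst ` carrier K"
    proof
      fix g assume "g \<in> carrier G"
      then have "(g, \<lambda>z. 0) \<in> carrier K" using m by (simp add: K_def)
      then show "g \<in> fst ` carrier K" by force
    qed
  qed (auto simp: K_def)
  have "kernel K G fst = center K"
  proof
    show "kernel K G fst \<subseteq> center K"
    proof
      fix x assume "x \<in> kernel K G fst"
      then obtain u where x: "x = (\<one>, u)" "x \<in> carrier K" by (cases x) (auto simp: kernel_def)
      have "x \<otimes>\<^bsub>K\<^esub> y = y \<otimes>\<^bsub>K\<^esub> x" if "y \<in> carrier K" for y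
      proof -
        obtain g v where y: "y = (g, v)" "g \<in> carrier G" using \<open>y \<in> carrier K\<close> by (cases y) (auto simp: K_def)
        have "(u t + v t + F t \<one> g) mod m = (v t + u t + F t g \<one>) mod m" for t
        proof -
          have "(u t + v t + F t \<one> g) mod m = (u t + v t) mod m"
            using F1(2)[OF y(2), of t] by (metis add.right_neutral mod_add_right_eq)
          also have "\<dots> = (v t + u t + F t g \<one>) mod m"
            using F1(1)[OF y(2), of t] by (metis add.commute add.right_neutral mod_add_right_eq)
          finally show ?thesis .
        qed
        then show ?thesis using x y by (simp add: K_def)
      qed
      then show "x \<in> center K" using x by (simp add: center_def)
    qed
    show "center K \<subseteq> kernel K G fst"
    proof
      fix x assume x: "x \<in> center K"
      then obtain g u where gu: "x = (g, u)" "g \<in> carrier G" by (auto simp: center_def K_def)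
      have gZ: "g \<in> center G" using hom_center_subset[OF hom surj x] gu by simp
      have "g = \<one>"
      proof (rule ccontr)
        assume "g \<noteq> \<one>"
        then obtain h where h: "h \<in> carrier G" "\<not> [F g g h = F g h g] (mod m)" using Fz[OF gZ] by auto
        have "(h, \<lambda>z. 0) \<in> carrier K" using h m by (simp add: K_def)
        then have "x \<otimes>\<^bsub>K\<^esub> (h, \<lambda>z. 0) = (h, \<lambda>z. 0) \<otimes>\<^bsub>K\<^esub> x" using x by (simp add: center_def)
        then have "(u g + F g g h) mod m = (u g + F g h g) mod m"
          using gu by (auto simp: K_def dest: fun_cong)
        then have "[F g g h = F g h g] (mod m)" by (simp add: cong_def[symmetric] cong_add_lcancel)
        then show False using h by simp
      qed
      then show "x \<in> kernel K G fst" using x gu by (simp add: kernel_def center_def)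
    qed
  qed
  then show ?thesis using capableI[OF G K isomorphic_Mod_center[OF K G hom surj]] by simp
qed

text \<open>Replaces the quotient by a surjection \<open>f\<close> with kernel
  \<open>center K\<close>, so that lifts of elements of \<open>G\<close> and their commutators can
  be handled without cosets.\<close>

lemma capableE:
  fixes G :: "('a, 'b) monoid_scheme"
  assumes "capable G" "group G"
  obtains K :: "'a list monoid" and f where "group K" "f \<in> hom K G" "f ` carrier K = carrier G"
    "\<And>k. k \<in> carrier K \<Longrightarrow> f k = \<one>\<^bsub>G\<^esub> \<longleftrightarrow> k \<in> center K"
proof -
  interpret G: group G by fact
  from assms obtain K :: "'a list monoid" where K: "group K" and iso: "G \<cong> K Mod center K"
    by (auto simp: capable_def)
  interpret K: group K by fact
  interpret Z: normal "center K" K using center_normal[OF K] .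
  have "K Mod center K \<cong> G" using G.iso_sym[OF iso] .
  then obtain \<phi> where \<phi>: "\<phi> \<in> iso (K Mod center K) G" by (auto simp: is_iso_def)
  then have \<phi>h: "\<phi> \<in> hom (K Mod center K) G"
    and \<phi>b: "bij_betw \<phi> (carrier (K Mod center K)) (carrier G)" by (auto simp: iso_def)
  define f where "f x = \<phi> (center K #>\<^bsub>K\<^esub> x)" for x
  show thesis
  proof (rule that[OF K])
    show "f \<in> hom K G"
      using hom_compose[OF Z.r_coset_hom_Mod \<phi>h] unfolding f_def comp_def .
    show "f ` carrier K = carrier G"
      using \<phi>b by (auto simp: bij_betw_def f_def carrier_FactGroup image_image)
    fix x assume x: "x \<in> carrier K"
    have one: "\<phi> (center K) = \<one>\<^bsub>G\<^esub>"
      using hom_one[OF \<phi>h Z.factorgroup_is_group] assms by simp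
    have "center K #>\<^bsub>K\<^esub> x \<in> carrier (K Mod center K)"
      "center K \<in> carrier (K Mod center K)"
      using x Z.factorgroup_is_group[THEN group.is_monoid, THEN monoid.one_closed]
      by (auto simp: carrier_FactGroup)
    then have "f x = \<one>\<^bsub>G\<^esub> \<longleftrightarrow> center K #>\<^bsub>K\<^esub> x = center K"
      using \<phi>b one unfolding f_def bij_betw_def by (metis inj_on_eq_iff)
    also have "\<dots> \<longleftrightarrow> x \<in> center K"
      using K.coset_join1[OF _ x Z.subgroup_axioms] K.coset_join2[OF x Z.subgroup_axioms]
        Z.subset by blast
    finally show "f x = \<one>\<^bsub>G\<^esub> \<longleftrightarrow> x \<in> center K" .
  qed
qed

section \<open>Commutators\<close>

text \<open>The convention is that of \<open>lower_central\<close> and \<open>derived\<close>, so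
  the generators of those subgroups are literally of this form.\<close>

definition commutator :: "('a, 'b) monoid_scheme \<Rightarrow> 'a \<Rightarrow> 'a \<Rightarrow> 'a" where
  "commutator G x y = x \<otimes>\<^bsub>G\<^esub> y \<otimes>\<^bsub>G\<^esub> inv\<^bsub>G\<^esub> x \<otimes>\<^bsub>G\<^esub> inv\<^bsub>G\<^esub> y"

context group
begin

lemma commutator_closed [simp]:
  "x \<in> carrier G \<Longrightarrow> y \<in> carrier G \<Longrightarrow> commutator G x y \<in> carrier G"
  by (simp add: commutator_def)

lemma mult_eq_commutator_mult:
  "x \<in> carrier G \<Longrightarrow> y \<in> carrier G \<Longrightarrow> x \<otimes> y = commutator G x y \<otimes> (y \<otimes> x)"
  by (simp add: commutator_def m_assoc) (simp add: m_assoc[symmetric])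

lemma commutator_eq_one_iff:
  assumes "x \<in> carrier G" "y \<in> carrier G"
  shows "commutator G x y = \<one> \<longleftrightarrow> x \<otimes> y = y \<otimes> x"
proof -
  have "x \<otimes> y = y \<otimes> x \<longleftrightarrow> commutator G x y \<otimes> (y \<otimes> x) = \<one> \<otimes> (y \<otimes> x)"
    using assms mult_eq_commutator_mult[OF assms] by simp
  also have "\<dots> \<longleftrightarrow> commutator G x y = \<one>" using assms by (metis commutator_closed m_closed one_closed r_cancel)
  finally show ?thesis by simp
qed

lemma center_commute: "c \<in> center G \<Longrightarrow> x \<in> carrier G \<Longrightarrow> c \<otimes> x = x \<otimes> c"
  by (simp add: center_def)

lemma center_in_carrier: "c \<in> center G \<Longrightarrow> c \<in> carrier G"
  by (simp add: center_def)

lemma center_subgroup: "subgroup (center G) G"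
  using center_normal[OF is_group] by (rule normal_imp_subgroup)

lemma inv_commute:
  assumes "x \<in> carrier G" "y \<in> carrier G" "x \<otimes> y = y \<otimes> x"
  shows "inv x \<otimes> y = y \<otimes> inv x"
proof -
  have "inv x \<otimes> y = inv x \<otimes> (y \<otimes> x) \<otimes> inv x" using assms(1,2) by (simp add: m_assoc)
  also have "\<dots> = y \<otimes> inv x" using assms by (simp add: m_assoc[symmetric] flip: assms(3))
  finally show ?thesis .
qed

lemma inv_mult_cancel:
  assumes "x \<in> carrier G" "y \<in> carrier G"
  shows "inv x \<otimes> (x \<otimes> y) = y" "x \<otimes> (inv x \<otimes> y) = y"
  using assms by (simp_all add: m_assoc[symmetric])

text \<open>An identity of free groups: after expansion everything cancels. The inverses are placed
  to suit the convention chosen for \<open>commutator\<close>.\<close>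

lemma Hall_Witt:
  assumes "x \<in> carrier G" "y \<in> carrier G" "z \<in> carrier G"
  shows "(inv y \<otimes> commutator G (commutator G y (inv x)) (inv z) \<otimes> y)
    \<otimes> (inv z \<otimes> commutator G (commutator G z (inv y)) (inv x) \<otimes> z)
    \<otimes> (inv x \<otimes> commutator G (commutator G x (inv z)) (inv y) \<otimes> x) = \<one>"
  using assms by (simp add: commutator_def m_assoc inv_mult_group inv_mult_cancel)

lemma int_pow_commute:
  fixes n :: int
  assumes x: "x \<in> carrier G" and y: "y \<in> carrier G" and "x \<otimes> y = y \<otimes> x"
  shows "x [^] n \<otimes> y = y \<otimes> x [^] n"
proof -
  have nat: "x [^] k \<otimes> y = y \<otimes> x [^] k" for k :: nat
  proof (induct k)
    case (Suc k)
    have "x [^] Suc k \<otimes> y = x [^] k \<otimes> (y \<otimes> x)" using x y assms(3) by (simp add: m_assoc)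
    also have "\<dots> = y \<otimes> x [^] Suc k" using x y Suc by (simp add: m_assoc[symmetric])
    finally show ?case .
  qed (use x y in simp)
  show ?thesis
  proof (cases n rule: int_cases2)
    case (nonneg k)
    then show ?thesis using nat[of k] by (simp add: int_pow_int)
  next
    case (nonpos k)
    then show ?thesis using inv_commute[OF _ y nat[of k]] x by (simp add: int_pow_neg_int)
  qed
qed

text \<open>The element-wise form of the three subgroups lemma.\<close>

lemma commutator_rotate:
  assumes x: "x \<in> carrier G" and y: "y \<in> carrier G" and z: "z \<in> carrier G"
    and c1: "commutator G y (inv x) \<otimes> z = z \<otimes> commutator G y (inv x)"
    and c2: "commutator G z (inv y) \<otimes> x = x \<otimes> commutator G z (inv y)"
  shows "commutator G x (inv z) \<otimes> y = y \<otimes> commutator G x (inv z)"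
proof -
  \<comment> \<open>By the hypotheses two of the factors in \<open>Hall_Witt\<close> are trivial,
    and a conjugate of the third double commutator remains.\<close>
  have "commutator G (commutator G y (inv x)) (inv z) = \<one>"
    "commutator G (commutator G z (inv y)) (inv x) = \<one>"
    using x y z inv_commute[OF z _ c1[symmetric]] inv_commute[OF x _ c2[symmetric]]
    by (simp_all add: commutator_eq_one_iff)
  then have e: "inv x \<otimes> commutator G (commutator G x (inv z)) (inv y) \<otimes> x = \<one>"
    using Hall_Witt[OF x y z] x y z by simp
  let ?c = "commutator G (commutator G x (inv z)) (inv y)"
  have "?c = x \<otimes> (inv x \<otimes> ?c \<otimes> x) \<otimes> inv x" using x y z by (simp add: m_assoc inv_mult_cancel)
  then have "?c = \<one>" using e x by simp
  then have "inv y \<otimes> commutator G x (inv z) = commutator G x (inv z) \<otimes> inv y"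
    using x y z by (simp add: commutator_eq_one_iff)
  then show ?thesis using inv_commute[of "inv y" "commutator G x (inv z)"] x y z by simp
qed

end

section \<open>Noncapable groups\<close>

text \<open>Every element of \<open>K\<close> is a power of a lift \<open>u\<close> of a generator
  times a central element. So \<open>u\<close> commutes with everything, lies in the center, and its
  image, the generator, is trivial.\<close>

lemma cyclic_not_capable:
  assumes G: "group G" and cyc: "cyclic_group G" and nt: "\<not> trivial_group G"
  shows "\<not> capable G"
proof
  assume "capable G"
  then obtain K :: "'a list monoid" and f where K: "group K" and hom: "f \<in> hom K G"
    and surj: "f ` carrier K = carrier G"
    and ker: "\<And>k. k \<in> carrier K \<Longrightarrow> f k = \<one>\<^bsub>G\<^esub> \<longleftrightarrow> k \<in> center K"
    using capableE[OF _ G] by blast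
  interpret G: group G by fact
  interpret K: group K by fact
  interpret f: group_hom K G f using hom by unfold_locales
  obtain x where x: "x \<in> carrier G" and gen: "carrier G = range (\<lambda>n::int. x [^]\<^bsub>G\<^esub> n)"
    using cyc G.cyclic_group by auto
  obtain u where u: "u \<in> carrier K" "f u = x" using x surj by (metis imageE)
  have decomp: "\<exists>n::int. \<exists>c\<in>center K. k = u [^]\<^bsub>K\<^esub> n \<otimes>\<^bsub>K\<^esub> c" if k: "k \<in> carrier K" for k
  proof -
    have "f k \<in> carrier G" using k by simp
    then obtain n :: int where n: "f k = x [^]\<^bsub>G\<^esub> n" using gen by auto
    let ?c = "inv\<^bsub>K\<^esub> (u [^]\<^bsub>K\<^esub> n) \<otimes>\<^bsub>K\<^esub> k"
    have "f ?c = \<one>\<^bsub>G\<^esub>" using u k n x by (simp add: f.hom_int_pow)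
    then have "?c \<in> center K" using ker[of ?c] u k by simp
    moreover have "k = u [^]\<^bsub>K\<^esub> n \<otimes>\<^bsub>K\<^esub> ?c" using u k by (simp add: K.m_assoc[symmetric])
    ultimately show ?thesis by blast
  qed
  have comm_u: "k \<otimes>\<^bsub>K\<^esub> u = u \<otimes>\<^bsub>K\<^esub> k" if k: "k \<in> carrier K" for k
  proof -
    obtain n :: int and c where c: "c \<in> center K" "k = u [^]\<^bsub>K\<^esub> n \<otimes>\<^bsub>K\<^esub> c" using decomp[OF k] by blast
    have cc: "c \<in> carrier K" "c \<otimes>\<^bsub>K\<^esub> u = u \<otimes>\<^bsub>K\<^esub> c" using c(1) u by (auto simp: center_def)
    have pu: "u [^]\<^bsub>K\<^esub> n \<otimes>\<^bsub>K\<^esub> u = u \<otimes>\<^bsub>K\<^esub> u [^]\<^bsub>K\<^esub> n"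
      using K.int_pow_mult[OF u(1), of n 1] K.int_pow_mult[OF u(1), of 1 n] u by (simp add: add.commute)
    have "k \<otimes>\<^bsub>K\<^esub> u = u [^]\<^bsub>K\<^esub> n \<otimes>\<^bsub>K\<^esub> u \<otimes>\<^bsub>K\<^esub> c" using c(2) cc u by (simp add: K.m_assoc)
    then show ?thesis using pu c(2) cc u by (simp add: K.m_assoc)
  qed
  have "u \<in> center K" using u comm_u by (simp add: center_def)
  then have "x = \<one>\<^bsub>G\<^esub>" using ker[OF u(1)] u(2) by simp
  then have "carrier G = {\<one>\<^bsub>G\<^esub>}" using gen by auto
  then show False using nt G.trivial_group_subset by simp
qed

lemma extraspecial_p5_not_capable:
  fixes G :: "('a, 'b) monoid_scheme" (structure)
  assumes p: "Factorial_Ring.prime p" and es: "extraspecial p G" and ord: "order G = p ^ 5"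
  shows "\<not> capable G"
proof
  assume "capable G"
  have G: "group G" using es by (simp add: extraspecial_def)
  interpret group G by fact
  obtain K :: "'a list monoid" and f where K: "group K" and hom: "f \<in> hom K G"
    and surj: "f ` carrier K = carrier G"
    and ker: "\<And>k. k \<in> carrier K \<Longrightarrow> f k = \<one> \<longleftrightarrow> k \<in> center K"
    using capableE[OF \<open>capable G\<close> G] by blast
  interpret K: group K by fact
  interpret f: group_hom K G f using hom by unfold_locales
  interpret Z: normal "center G" G using center_normal[OF G] .
  have p1: "p > 1" using p prime_gt_1_nat by blast
  have fin: "finite (carrier G)" using ord p1 by (simp add: order_def card_ge_0_finite)
  have cardZ: "card (center G) = p" using es by (simp add: extraspecial_def)
  have finZ: "finite (center G)" using cardZ p1 by (intro card_ge_0_finite) simp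
  have comZ: "commutator G x y \<in> center G" if "x \<in> carrier G" "y \<in> carrier G" for x y
  proof -
    have cm: "comm_group (G Mod center G)" using es by (simp add: extraspecial_def)
    have "center G #> (x \<otimes> y) = center G #> (y \<otimes> x)"
      using that comm_group.axioms(1)[OF cm] comm_monoid.m_comm[of "G Mod center G" "center G #> x" "center G #> y"]
      by (simp add: carrier_FactGroup Z.rcos_sum)
    then have "x \<otimes> y \<in> center G #> (y \<otimes> x)"
      using that Z.subgroup_axioms rcos_self[of "x \<otimes> y" "center G"] by simp
    then obtain c where c: "c \<in> center G" "x \<otimes> y = c \<otimes> (y \<otimes> x)" by (auto simp: r_coset_def)
    have "commutator G x y \<otimes> (y \<otimes> x) = c \<otimes> (y \<otimes> x)"
      using mult_eq_commutator_mult[OF that] c(2) by (rule trans[OF sym])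
    moreover have "c \<in> carrier G" using c(1) Z.subset by blast
    ultimately have "commutator G x y = c" using that by simp
    then show ?thesis using c by simp
  qed
  have gen: "\<exists>n::int. z = u [^] n" if "u \<in> center G" "u \<noteq> \<one>" "z \<in> center G" for u z
  proof -
    have u: "u \<in> carrier G" and z: "z \<in> carrier G" using that Z.subset by auto
    let ?H = "generate G {u}"
    let ?Z = "G\<lparr>carrier := center G\<rparr>"
    have sub: "subgroup ?H G" using u by (simp add: generate_is_subgroup)
    have HZ: "?H \<subseteq> center G" using that(1) generate_subgroup_incl[OF _ Z.subgroup_axioms] by simp
    have "subgroup ?H ?Z" using subgroup_incl[OF sub Z.subgroup_axioms HZ] .
    then have "card (rcosets\<^bsub>?Z\<^esub> ?H) * card ?H = order ?Z"
      by (rule group.lagrange[OF Z.subgroup_is_group[OF G]])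
    then have "card ?H dvd order ?Z" by (metis dvd_triv_right)
    then have "card ?H dvd p" using cardZ by (simp add: order_def)
    moreover have "card ?H \<noteq> 1"
    proof
      assume "card ?H = 1"
      moreover have "u \<in> ?H" "\<one> \<in> ?H" by (auto intro: generate.intros)
      ultimately show False using that(2) by (metis card_1_singletonE singletonD)
    qed
    ultimately have "card ?H = p" using p by (metis prime_nat_iff)
    then have "?H = center G" using HZ finZ cardZ by (simp add: card_subset_eq)
    then show ?thesis using that(3) generate_pow[OF u] by auto
  qed
  \<comment> \<open>The map sending \<open>h\<close> to its commutators with \<open>x\<close> and
    \<open>y\<close> has at most \<open>p ^ 2\<close> values, so one fibre has at least
    \<open>p ^ 3\<close> elements. Two elements of a fibre differ by an element that centralizes
    \<open>x\<close> and \<open>y\<close>; if all such elements were central, the fibre would lie in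
    one coset of the center and have at most \<open>p\<close> elements.\<close>
  have centralizes_two: "\<exists>a\<in>carrier G. a \<notin> center G \<and> a \<otimes> x = x \<otimes> a \<and> a \<otimes> y = y \<otimes> a"
    if x: "x \<in> carrier G" and y: "y \<in> carrier G" for x y
  proof (rule ccontr)
    assume "\<not> ?thesis"
    then have inZ: "a \<in> center G" if "a \<in> carrier G" "a \<otimes> x = x \<otimes> a" "a \<otimes> y = y \<otimes> a" for a
      using that by blast
    let ?\<phi> = "\<lambda>h. (commutator G h x, commutator G h y)"
    let ?B = "center G \<times> center G"
    have "?\<phi> \<in> carrier G \<rightarrow> ?B" using x y comZ by simp
    moreover have "?B \<noteq> {}" using Z.one_closed by blast
    ultimately obtain b where b: "b \<in> ?B" "card (?\<phi> -` {b} \<inter> carrier G) * card ?B \<ge> card (carrier G)"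
      using pigeonhole_card[of ?\<phi> "carrier G" ?B] fin finZ by auto
    let ?S = "?\<phi> -` {b} \<inter> carrier G"
    have com_eq: "(inv h \<otimes> k) \<otimes> u = u \<otimes> (inv h \<otimes> k)"
      if h: "h \<in> carrier G" and k: "k \<in> carrier G" and u: "u \<in> carrier G"
        and e: "commutator G h u = commutator G k u" for h k u
    proof -
      have "h \<otimes> u \<otimes> inv h = k \<otimes> u \<otimes> inv k"
        using e h k u unfolding commutator_def by simp
      then have "inv h \<otimes> (h \<otimes> u \<otimes> inv h) \<otimes> k = inv h \<otimes> (k \<otimes> u \<otimes> inv k) \<otimes> k" by simp
      then show ?thesis using h k u by (simp add: m_assoc inv_mult_cancel)
    qed
    have "card ?S \<le> p"
    proof (cases "?S = {}")
      case False
      then obtain h where h: "h \<in> ?S" by blast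
      have "?S \<subseteq> (\<lambda>c. h \<otimes> c) ` center G"
      proof
        fix k assume k: "k \<in> ?S"
        then have "inv h \<otimes> k \<in> center G" using h x y by (intro inZ com_eq) auto
        then show "k \<in> (\<lambda>c. h \<otimes> c) ` center G" using h k by (intro image_eqI[of _ _ "inv h \<otimes> k"]) (auto simp: inv_mult_cancel)
      qed
      then have "card ?S \<le> card (center G)" using finZ by (meson card_image_le card_mono finite_imageI le_trans)
      then show ?thesis using cardZ by simp
    qed simp
    then have "card ?S * card ?B \<le> p * (p * p)" using cardZ by (simp add: card_cartesian_product)
    then have "p ^ 5 \<le> p ^ 3" using b(2) ord by (simp add: order_def power3_eq_cube mult.assoc)
    then show False using p1 power_le_imp_le_exp[of p 5 3] by simp
  qed
  obtain z0 where z0: "z0 \<in> center G" "z0 \<noteq> \<one>"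
  proof -
    have "center G \<noteq> {\<one>}" using cardZ p1 by auto
    then show thesis using that Z.one_closed by blast
  qed
  obtain t where t: "t \<in> carrier K" "f t = z0" using z0 surj Z.subset by (metis imageE subsetD)
  \<comment> \<open>Each nontrivial element generates the center of \<open>G\<close>, so
    \<open>v\<close> is a power of \<open>u\<close> times an element of \<open>center K\<close>.
    Hence one lift of a nontrivial central element commuting with \<open>k\<close> forces all lifts
    of central elements to commute with \<open>k\<close>.\<close>
  have transfer: "v \<otimes>\<^bsub>K\<^esub> k = k \<otimes>\<^bsub>K\<^esub> v"
    if k: "k \<in> carrier K" and u: "u \<in> carrier K" "f u \<in> center G" "f u \<noteq> \<one>"
      and v: "v \<in> carrier K" "f v \<in> center G" and ku: "u \<otimes>\<^bsub>K\<^esub> k = k \<otimes>\<^bsub>K\<^esub> u" for k u v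
  proof -
    obtain n :: int where n: "f v = f u [^] n" using gen[OF u(2,3) v(2)] by blast
    let ?c = "inv\<^bsub>K\<^esub> (u [^]\<^bsub>K\<^esub> n) \<otimes>\<^bsub>K\<^esub> v"
    have "f ?c = \<one>" using u v n by (simp add: f.hom_int_pow)
    then have cc: "?c \<in> center K" using ker[of ?c] u v by simp
    have ve: "v = u [^]\<^bsub>K\<^esub> n \<otimes>\<^bsub>K\<^esub> ?c" using u v by (simp add: K.m_assoc[symmetric])
    have un: "u [^]\<^bsub>K\<^esub> n \<otimes>\<^bsub>K\<^esub> k = k \<otimes>\<^bsub>K\<^esub> u [^]\<^bsub>K\<^esub> n" by (rule K.int_pow_commute[OF u(1) k ku])
    have [simp]: "?c \<in> carrier K" using cc by (rule K.center_in_carrier)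
    have "u [^]\<^bsub>K\<^esub> n \<otimes>\<^bsub>K\<^esub> ?c \<otimes>\<^bsub>K\<^esub> k = u [^]\<^bsub>K\<^esub> n \<otimes>\<^bsub>K\<^esub> (k \<otimes>\<^bsub>K\<^esub> ?c)"
      using k u K.center_commute[OF cc k] by (simp only: K.m_assoc K.int_pow_closed \<open>?c \<in> carrier K\<close>)
    also have "\<dots> = k \<otimes>\<^bsub>K\<^esub> u [^]\<^bsub>K\<^esub> n \<otimes>\<^bsub>K\<^esub> ?c"
      using k u un by (simp only: K.m_assoc[symmetric] K.int_pow_closed \<open>?c \<in> carrier K\<close>)
    also have "\<dots> = k \<otimes>\<^bsub>K\<^esub> (u [^]\<^bsub>K\<^esub> n \<otimes>\<^bsub>K\<^esub> ?c)"
      using k u by (simp only: K.m_assoc K.int_pow_closed \<open>?c \<in> carrier K\<close>)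
    finally show ?thesis by (simp only: ve[symmetric])
  qed
  have fcom: "f (commutator K x y) = commutator G (f x) (f y)"
    if "x \<in> carrier K" "y \<in> carrier K" for x y
    using that by (simp add: commutator_def)
  \<comment> \<open>If the images commute, the commutator lies in the kernel of \<open>f\<close>,
    which is the center of \<open>K\<close>. The inverse is there to fit
    \<open>commutator_rotate\<close>.\<close>
  have com_center: "commutator K x (inv\<^bsub>K\<^esub> y) \<otimes>\<^bsub>K\<^esub> k = k \<otimes>\<^bsub>K\<^esub> commutator K x (inv\<^bsub>K\<^esub> y)"
    if "x \<in> carrier K" "y \<in> carrier K" "k \<in> carrier K" "f x \<otimes> f y = f y \<otimes> f x" for x y k
  proof -
    have "commutator G (f x) (inv (f y)) = \<one>"
      using that inv_commute[of "f y" "f x"] by (simp add: commutator_eq_one_iff)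
    then have "f (commutator K x (inv\<^bsub>K\<^esub> y)) = \<one>" using that fcom by simp
    then have "commutator K x (inv\<^bsub>K\<^esub> y) \<in> center K" using ker that by simp
    then show ?thesis using that K.center_commute by simp
  qed
  have "w \<otimes>\<^bsub>K\<^esub> t = t \<otimes>\<^bsub>K\<^esub> w" if w: "w \<in> carrier K" for w
  proof (cases "f w \<in> center G")
    case True
    show ?thesis
    proof (cases "f w = \<one>")
      case True
      then show ?thesis using ker[OF w] K.center_commute t by simp
    next
      case False
      then show ?thesis using transfer[OF w w \<open>f w \<in> center G\<close> _ t(1)] t z0 by simp
    qed
  next
    case False
    have fw: "f w \<in> carrier G" using w by simp
    \<comment> \<open>The choices serve to have two noncommuting pairs, \<open>f w\<close> with
      \<open>g0\<close> and \<open>a0\<close> with \<open>y0\<close>, while \<open>a0\<close>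
      commutes with \<open>f w\<close> and with \<open>g0\<close>. The noncommuting pairs yield
      lifts of nontrivial central elements, to which \<open>transfer\<close> applies.\<close>
    then obtain g0 where g0: "g0 \<in> carrier G" "f w \<otimes> g0 \<noteq> g0 \<otimes> f w" using False unfolding center_def by blast
    obtain a0 where a0: "a0 \<in> carrier G" "a0 \<notin> center G" "a0 \<otimes> f w = f w \<otimes> a0" "a0 \<otimes> g0 = g0 \<otimes> a0"
      using centralizes_two[OF fw g0(1)] by blast
    obtain y0 where y0: "y0 \<in> carrier G" "a0 \<otimes> y0 \<noteq> y0 \<otimes> a0" using a0(1,2) unfolding center_def by blast
    have lift: "\<exists>k\<in>carrier K. f k = x" if "x \<in> carrier G" for x
      using that surj by (metis imageE)
    obtain g where g: "g \<in> carrier K" "f g = g0" using lift[OF g0(1)] by blast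
    obtain a where a: "a \<in> carrier K" "f a = a0" using lift[OF a0(1)] by blast
    obtain y where y: "y \<in> carrier K" "f y = y0" using lift[OF y0(1)] by blast
    have nt: "f (commutator K u (inv\<^bsub>K\<^esub> v)) \<noteq> \<one>"
      if "u \<in> carrier K" "v \<in> carrier K" "f u \<otimes> f v \<noteq> f v \<otimes> f u" for u v
    proof
      assume "f (commutator K u (inv\<^bsub>K\<^esub> v)) = \<one>"
      then have "inv (f v) \<otimes> f u = f u \<otimes> inv (f v)" using that by (simp add: fcom commutator_eq_one_iff)
      then show False using that inv_commute[of "inv (f v)" "f u"] by simp
    qed
    have cent: "f (commutator K u v) \<in> center G" if "u \<in> carrier K" "v \<in> carrier K" for u v
      using that fcom comZ by simp
    \<comment> \<open>First use of the three subgroups lemma, for \<open>w\<close>,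
      \<open>a\<close>, \<open>g\<close>. Then \<open>transfer\<close> passes from the commutator of
      \<open>w\<close> and \<open>inv g\<close> to that of \<open>y\<close> and
      \<open>inv w\<close>.\<close>
    have "commutator K w (inv\<^bsub>K\<^esub> g) \<otimes>\<^bsub>K\<^esub> a = a \<otimes>\<^bsub>K\<^esub> commutator K w (inv\<^bsub>K\<^esub> g)"
      using K.commutator_rotate[OF w a(1) g(1)] com_center a0 g a w by simp
    then have ya: "commutator K y (inv\<^bsub>K\<^esub> w) \<otimes>\<^bsub>K\<^esub> a = a \<otimes>\<^bsub>K\<^esub> commutator K y (inv\<^bsub>K\<^esub> w)"
      using transfer[OF a(1), of "commutator K w (inv\<^bsub>K\<^esub> g)" "commutator K y (inv\<^bsub>K\<^esub> w)"]
        nt[of w g] cent[of w "inv\<^bsub>K\<^esub> g"] cent[of y "inv\<^bsub>K\<^esub> w"] w g g0 y by simp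
    \<comment> \<open>Second use, for \<open>a\<close>, \<open>w\<close>, \<open>y\<close>, with
      \<open>ya\<close> as one of the hypotheses. Now \<open>transfer\<close> passes from the
      commutator of \<open>a\<close> and \<open>inv y\<close> to \<open>t\<close>.\<close>
    have "commutator K a (inv\<^bsub>K\<^esub> y) \<otimes>\<^bsub>K\<^esub> w = w \<otimes>\<^bsub>K\<^esub> commutator K a (inv\<^bsub>K\<^esub> y)"
      using K.commutator_rotate[OF a(1) w y(1) _ ya] com_center[of w a y] a0 a y w by simp
    then show ?thesis
      using transfer[OF w, of "commutator K a (inv\<^bsub>K\<^esub> y)" t] nt[of a y] cent[of a "inv\<^bsub>K\<^esub> y"]
        a y y0 t z0 by simp
  qed
  then have "t \<in> center K" using t by (simp add: center_def)
  then show False using ker[OF t(1)] t z0 by simp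
qed

section \<open>The Baer correspondence\<close>

lemma prime_inverse_cong:
  fixes k :: int
  assumes "Factorial_Ring.prime p" "\<not> [k = 0] (mod int p)"
  obtains j where "[k * j = 1] (mod int p)"
proof -
  have "\<not> int p dvd k" using assms(2) by (simp add: cong_0_iff)
  moreover have "Factorial_Ring.prime (int p)" using assms(1) by (simp add: prime_nat_int_transfer)
  ultimately have "coprime k (int p)" by (metis prime_imp_coprime coprime_commute)
  then obtain j where "[k * j = 1] (mod int p)" using cong_solve_coprime_int by blast
  then show thesis by (rule that)
qed

lemma (in group) int_pow_cong:
  fixes a b :: int
  assumes x: "x \<in> carrier G" and "x [^] p = \<one>" and "[a = b] (mod int p)"
  shows "x [^] a = x [^] b"
proof -
  obtain c where "b = a + int p * c" using assms(3) by (auto simp: cong_iff_lin)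
  moreover have "x [^] (int p * c) = \<one>"
    using x assms(2) by (simp add: int_pow_pow[symmetric] int_pow_int)
  ultimately show ?thesis using x by (simp add: int_pow_mult)
qed

text \<open>By Zorn's lemma there is a subgroup \<open>M\<close> maximal among those containing
  \<open>H\<close> and avoiding \<open>x\<close>. It is a complement of the subgroup generated by
  \<open>x\<close>, and \<open>f\<close> is the exponent of \<open>x\<close> in the decomposition.
  Finiteness is not assumed.\<close>

lemma (in comm_group) separating_functional:
  assumes p: "Factorial_Ring.prime p" and ex: "\<And>u. u \<in> carrier G \<Longrightarrow> u [^] p = \<one>"
    and H: "subgroup H G" and x: "x \<in> carrier G" "x \<notin> H"
  obtains f :: "'a \<Rightarrow> int"
  where "\<And>u v. u \<in> carrier G \<Longrightarrow> v \<in> carrier G \<Longrightarrow> [f (u \<otimes> v) = f u + f v] (mod int p)"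
    and "\<And>h. h \<in> H \<Longrightarrow> [f h = 0] (mod int p)" and "[f x = 1] (mod int p)"
proof -
  define \<A> where "\<A> = {M. subgroup M G \<and> H \<subseteq> M \<and> x \<notin> M}"
  have "\<exists>M\<in>\<A>. \<forall>N\<in>\<A>. M \<subseteq> N \<longrightarrow> N = M"
  proof (rule subset_Zorn_nonempty)
    show "\<A> \<noteq> {}" using H x by (auto simp: \<A>_def)
    fix C assume "C \<noteq> {}" and "subset.chain \<A> C"
    then have C: "C \<noteq> {}" "\<And>M. M \<in> C \<Longrightarrow> subgroup M G \<and> H \<subseteq> M \<and> x \<notin> M"
      "\<And>M N. M \<in> C \<Longrightarrow> N \<in> C \<Longrightarrow> M \<subseteq> N \<or> N \<subseteq> M" by (auto simp: subset.chain_def \<A>_def)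
    have "subgroup (\<Union>C) G"
    proof
      show "\<Union>C \<subseteq> carrier G" using C(2) subgroup.subset by blast
      show "\<one> \<in> \<Union>C" using C(1,2) subgroup.one_closed by blast
      show "inv u \<in> \<Union>C" if "u \<in> \<Union>C" for u
        using that C(2) by (meson UnionE UnionI subgroup.m_inv_closed)
      fix u v assume "u \<in> \<Union>C" "v \<in> \<Union>C"
      then obtain M N where "M \<in> C" "u \<in> M" "N \<in> C" "v \<in> N" by blast
      then obtain L where "L \<in> C" "u \<in> L" "v \<in> L" using C(3)[of M N] by blast
      then show "u \<otimes> v \<in> \<Union>C" using C(2) by (meson UnionI subgroup.m_closed)
    qed
    moreover have "H \<subseteq> \<Union>C" using C(1,2) by (meson Union_upper all_not_in_conv subset_trans)
    moreover have "x \<notin> \<Union>C" using C(2) by blast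
    ultimately show "\<Union>C \<in> \<A>" by (simp add: \<A>_def)
  qed
  then obtain M where M: "subgroup M G" "H \<subseteq> M" "x \<notin> M"
    and max: "\<And>N. subgroup N G \<Longrightarrow> M \<subseteq> N \<Longrightarrow> x \<notin> N \<Longrightarrow> N = M" by (auto simp: \<A>_def)
  interpret M: subgroup M G by fact
  have pow_notin: "x [^] k \<notin> M" if k: "\<not> [k = 0] (mod int p)" for k :: int
  proof
    assume xk: "x [^] k \<in> M"
    obtain j where "[k * j = 1] (mod int p)" using prime_inverse_cong[OF p k] .
    then have "x [^] (k * j) = x [^] (1::int)" by (rule int_pow_cong[OF x(1) ex[OF x(1)]])
    then have "x = (x [^] k) [^] j" using x by (simp add: int_pow_pow)
    then show False using subgroup_int_pow_closed[OF M(1) xk, of j] M(3) by simp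
  qed
  have decomp: "\<exists>n::int. \<exists>m\<in>M. u = m \<otimes> x [^] n" if u: "u \<in> carrier G" for u
  proof (cases "u \<in> M")
    case True
    then show ?thesis using u by (intro exI[of _ 0] bexI[of _ u]) auto
  next
    case False
    \<comment> \<open>By maximality the subgroup generated by \<open>M\<close> and \<open>u\<close>
      contains \<open>x\<close>, say as \<open>m \<otimes> u [^] k\<close>. As \<open>x\<close> is
      not in \<open>M\<close>, the exponent \<open>k\<close> is invertible modulo \<open>p\<close>,
      and the equation can be solved for \<open>u\<close>.\<close>
    define N where "N = {m \<otimes> u [^] k | m k. m \<in> M \<and> k \<in> (UNIV :: int set)}"
    have N: "subgroup N G"
    proof
      show "N \<subseteq> carrier G" using u by (auto simp: N_def)
      show "\<one> \<in> N" unfolding N_def using M.one_closed u by (intro CollectI exI[of _ \<one>] exI[of _ 0]) simp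
      fix v assume "v \<in> N"
      then obtain m and k :: int where v: "v = m \<otimes> u [^] k" "m \<in> M" by (auto simp: N_def)
      have "inv v = inv m \<otimes> u [^] (- k)" using v u by (simp add: inv_mult int_pow_neg)
      then show "inv v \<in> N" using v unfolding N_def by blast
      fix w assume "w \<in> N"
      then obtain m' and k' :: int where w: "w = m' \<otimes> u [^] k'" "m' \<in> M" by (auto simp: N_def)
      have "v \<otimes> w = m \<otimes> m' \<otimes> u [^] (k + k')" using v w u by (simp add: int_pow_mult m_ac)
      then show "v \<otimes> w \<in> N" using v w M.m_closed unfolding N_def by blast
    qed
    have MN: "M \<subseteq> N"
    proof
      fix m assume "m \<in> M"
      then show "m \<in> N" unfolding N_def using u by (intro CollectI exI[of _ m] exI[of _ 0]) simp
    qed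
    have "u \<in> N" unfolding N_def using u M.one_closed by (intro CollectI exI[of _ \<one>] exI[of _ 1]) simp
    then have "x \<in> N" using max[OF N MN] False by blast
    then obtain m and k :: int where xm: "x = m \<otimes> u [^] k" "m \<in> M" by (auto simp: N_def)
    have k: "\<not> [k = 0] (mod int p)"
    proof
      assume "[k = 0] (mod int p)"
      then have "u [^] k = \<one>" using int_pow_cong[OF u ex[OF u], of k 0] by simp
      then show False using xm M(3) by simp
    qed
    obtain j where "[k * j = 1] (mod int p)" using prime_inverse_cong[OF p k] .
    then have "u [^] (k * j) = u [^] (1::int)" by (rule int_pow_cong[OF u ex[OF u]])
    then have "x [^] j = m [^] j \<otimes> u" using xm u by (simp add: int_pow_distrib int_pow_pow)
    moreover have mj: "m [^] j \<in> M" using subgroup_int_pow_closed[OF M(1) xm(2)] .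
    ultimately have "u = inv (m [^] j) \<otimes> x [^] j" using u by (simp add: m_assoc[symmetric])
    then show ?thesis using mj by blast
  qed
  \<comment> \<open>The exponent is an arbitrary choice; only its residue modulo \<open>p\<close> is
    determined, as \<open>funique\<close> shows.\<close>
  define f where "f u = (SOME n::int. \<exists>m\<in>M. u = m \<otimes> x [^] n)" for u
  have f: "\<exists>m\<in>M. u = m \<otimes> x [^] f u" if "u \<in> carrier G" for u
    unfolding f_def using someI_ex[OF decomp[OF that]] .
  have funique: "[f u = n] (mod int p)" if m: "m \<in> M" and u: "u = m \<otimes> x [^] n" for u m n
  proof (rule ccontr)
    assume "\<not> [f u = n] (mod int p)"
    then have "\<not> [f u - n = 0] (mod int p)" by (simp add: cong_diff_iff_cong_0)
    then have notin: "x [^] (f u - n) \<notin> M" by (rule pow_notin)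
    have "u \<in> carrier G" using m u x by simp
    then obtain m' where m': "m' \<in> M" "u = m' \<otimes> x [^] f u" using f by blast
    then have "m' \<otimes> x [^] (f u - n) \<otimes> x [^] n = m \<otimes> x [^] n"
      using u x by (simp add: m_assoc int_pow_mult[symmetric])
    then have "m' \<otimes> x [^] (f u - n) = m" using m m' x by simp
    then have "x [^] (f u - n) = inv m' \<otimes> m" using m m' x by (auto simp: m_assoc[symmetric])
    then show False using notin m m' by simp
  qed
  show thesis
  proof (rule that[of f])
    show "[f h = 0] (mod int p)" if "h \<in> H" for h
      using that M by (intro funique[of h]) auto
    show "[f x = 1] (mod int p)" using M.one_closed x by (intro funique[of \<one>]) auto
    fix u v assume uv: "u \<in> carrier G" "v \<in> carrier G"
    obtain m m' where mm: "m \<in> M" "u = m \<otimes> x [^] f u" "m' \<in> M" "v = m' \<otimes> x [^] f v"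
      using f[OF uv(1)] f[OF uv(2)] by blast
    have "u \<otimes> v = (m \<otimes> x [^] f u) \<otimes> (m' \<otimes> x [^] f v)" using mm(2,4) by (rule arg_cong2)
    also have "\<dots> = m \<otimes> m' \<otimes> x [^] (f u + f v)" using mm(1,3) x by (simp add: int_pow_mult m_ac)
    finally show "[f (u \<otimes> v) = f u + f v] (mod int p)"
      using mm(1,3) by (intro funique[of "m \<otimes> m'"]) simp_all
  qed
qed

section \<open>Commutators and halving in class two\<close>

locale class_two_group = group G for G (structure) +
  fixes p :: nat
  assumes prime_p: "Factorial_Ring.prime p" and odd_p: "odd p"
    and exponent: "x \<in> carrier G \<Longrightarrow> x [^] p = \<one>"
    and commutator_central: "x \<in> carrier G \<Longrightarrow> y \<in> carrier G \<Longrightarrow> commutator G x y \<in> center G"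
begin

abbreviation comm where "comm \<equiv> commutator G"
abbreviation Z where "Z \<equiv> center G"

text \<open>The inverse of 2 modulo \<open>p\<close>, as a natural number so that it can serve as an
  exponent.\<close>

definition half :: nat where "half = (p + 1) div 2"

lemma two_half: "2 * half = p + 1"
  using odd_p by (simp add: half_def)

lemma two_half_cong: "[2 * int half = 1] (mod int p)"
proof -
  have "2 * int half = int p + 1" using two_half by presburger
  then show ?thesis by (simp add: cong_def)
qed

lemma Z_carrier [simp]: "c \<in> Z \<Longrightarrow> c \<in> carrier G"
  by (rule center_in_carrier)

lemma comm_self [simp]: "x \<in> carrier G \<Longrightarrow> comm x x = \<one>"
  by (simp add: commutator_eq_one_iff)

lemma comm_center [simp]:
  "c \<in> Z \<Longrightarrow> x \<in> carrier G \<Longrightarrow> comm c x = \<one>" "c \<in> Z \<Longrightarrow> x \<in> carrier G \<Longrightarrow> comm x c = \<one>"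
proof -
  assume c: "c \<in> Z" and x: "x \<in> carrier G"
  show "comm c x = \<one>" using commutator_eq_one_iff[of c x] center_commute[OF c x] c x by simp
  show "comm x c = \<one>" using commutator_eq_one_iff[of x c] center_commute[OF c x] c x by simp
qed

lemma comm_swap: "x \<in> carrier G \<Longrightarrow> y \<in> carrier G \<Longrightarrow> comm y x = inv (comm x y)"
  by (simp add: commutator_def inv_mult_group m_assoc)

text \<open>Both commutators on the right are central and can be moved freely through the products;
  this makes the commutator bilinear.\<close>

lemma comm_mult_left:
  assumes x: "x \<in> carrier G" and y: "y \<in> carrier G" and w: "w \<in> carrier G"
  shows "comm (x \<otimes> y) w = comm x w \<otimes> comm y w"
proof -
  have c: "comm y w \<in> Z" "comm x w \<in> Z" "comm x w \<in> carrier G" "comm y w \<in> carrier G"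
    using commutator_central x y w by auto
  have "comm (x \<otimes> y) w \<otimes> (w \<otimes> (x \<otimes> y)) = x \<otimes> (y \<otimes> w)"
    using mult_eq_commutator_mult[of "x \<otimes> y" w] x y w by (simp add: m_assoc)
  also have "\<dots> = x \<otimes> comm y w \<otimes> (w \<otimes> y)"
    using mult_eq_commutator_mult[OF y w] x y w by (simp add: m_assoc)
  also have "\<dots> = comm y w \<otimes> (x \<otimes> w \<otimes> y)" using center_commute[OF c(1) x] x y w by (simp add: m_assoc[symmetric])
  also have "\<dots> = comm y w \<otimes> (comm x w \<otimes> (w \<otimes> x) \<otimes> y)"
    using mult_eq_commutator_mult[OF x w] by simp
  also have "\<dots> = comm y w \<otimes> comm x w \<otimes> (w \<otimes> (x \<otimes> y))" using x y w by (simp add: m_assoc)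
  finally have "comm (x \<otimes> y) w = comm y w \<otimes> comm x w" using x y w by simp
  then show ?thesis using center_commute[OF c(1,3)] by simp
qed

lemma comm_mult_right:
  assumes x: "x \<in> carrier G" and y: "y \<in> carrier G" and w: "w \<in> carrier G"
  shows "comm w (x \<otimes> y) = comm w x \<otimes> comm w y"
proof -
  have c: "comm x w \<in> Z" "comm y w \<in> Z" using commutator_central x y w by auto
  have "comm w (x \<otimes> y) = inv (comm x w \<otimes> comm y w)"
    using comm_swap[of "x \<otimes> y" w] comm_mult_left[OF x y w] x y w by simp
  also have "\<dots> = inv (comm y w \<otimes> comm x w)" using center_commute[OF c(1)] x y w by simp
  also have "\<dots> = comm w x \<otimes> comm w y"
    using comm_swap[OF x w] comm_swap[OF y w] x y w by (simp add: inv_mult_group)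
  finally show ?thesis .
qed

text \<open>The inverse of the square root of \<open>comm x y\<close>, hence the reversed arguments:
  multiplying \<open>x \<otimes> y\<close> by it makes the product symmetric.\<close>

definition baer_cocycle where "baer_cocycle x y = comm y x [^] half"

lemma center_nat_pow: "c \<in> Z \<Longrightarrow> c [^] (n::nat) \<in> Z"
  using subgroup_int_pow_closed[OF center_subgroup, of c "int n"] by (simp add: int_pow_int)

lemma baer_cocycle_central: "x \<in> carrier G \<Longrightarrow> y \<in> carrier G \<Longrightarrow> baer_cocycle x y \<in> Z"
  unfolding baer_cocycle_def by (intro center_nat_pow commutator_central)

lemma baer_cocycle_mult:
  assumes "x \<in> carrier G" "y \<in> carrier G" "w \<in> carrier G"
  shows "baer_cocycle (x \<otimes> y) w = baer_cocycle x w \<otimes> baer_cocycle y w"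
    and "baer_cocycle w (x \<otimes> y) = baer_cocycle w x \<otimes> baer_cocycle w y"
proof -
  have d: "(comm a b \<otimes> comm c d) [^] half = comm a b [^] half \<otimes> comm c d [^] half"
    if "a \<in> carrier G" "b \<in> carrier G" "c \<in> carrier G" "d \<in> carrier G" for a b c d
    by (rule pow_mult_distrib[OF center_commute[OF commutator_central]]) (use that in simp_all)
  show "baer_cocycle (x \<otimes> y) w = baer_cocycle x w \<otimes> baer_cocycle y w"
    and "baer_cocycle w (x \<otimes> y) = baer_cocycle w x \<otimes> baer_cocycle w y"
    unfolding baer_cocycle_def using assms by (simp_all add: comm_mult_left comm_mult_right d)
qed

lemma baer_cocycle_center:
  "c \<in> Z \<Longrightarrow> x \<in> carrier G \<Longrightarrow> baer_cocycle c x = \<one>"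
  "c \<in> Z \<Longrightarrow> x \<in> carrier G \<Longrightarrow> baer_cocycle x c = \<one>"
  by (simp_all add: baer_cocycle_def)

text \<open>The Baer correspondence: dividing out half of each commutator turns \<open>G\<close> into an
  elementary abelian group on the same carrier, with the same powers and more subgroups.\<close>

definition baer :: "'a monoid" where
  "baer = \<lparr>carrier = carrier G, monoid.mult = (\<lambda>x y. x \<otimes> y \<otimes> baer_cocycle x y), one = \<one>\<rparr>"

lemma baer_simps [simp]: "carrier baer = carrier G" "\<one>\<^bsub>baer\<^esub> = \<one>"
  by (simp_all add: baer_def)

lemma baer_mult: "x \<otimes>\<^bsub>baer\<^esub> y = x \<otimes> y \<otimes> baer_cocycle x y"
  by (simp add: baer_def)

lemma baer_comm_group: "comm_group baer"
proof (rule comm_groupI)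
  fix x y w assume "x \<in> carrier baer" "y \<in> carrier baer" "w \<in> carrier baer"
  then have x: "x \<in> carrier G" and y: "y \<in> carrier G" and w: "w \<in> carrier G" by simp_all
  let ?b = baer_cocycle
  have b: "?b x y \<in> Z" "?b x w \<in> Z" "?b y w \<in> Z" using x y w by (simp_all add: baer_cocycle_central)
  have bc: "?b x y \<in> carrier G" "?b x w \<in> carrier G" "?b y w \<in> carrier G" using b by simp_all
  have "x \<otimes>\<^bsub>baer\<^esub> y \<otimes>\<^bsub>baer\<^esub> w = x \<otimes> y \<otimes> (?b x y \<otimes> w) \<otimes> (?b x w \<otimes> ?b y w)"
    using x y w bc b by (simp add: baer_mult baer_cocycle_mult baer_cocycle_center m_assoc)
  also have "?b x y \<otimes> w = w \<otimes> ?b x y" using center_commute[OF b(1) w] .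
  also have "x \<otimes> y \<otimes> (w \<otimes> ?b x y) \<otimes> (?b x w \<otimes> ?b y w)
      = x \<otimes> y \<otimes> w \<otimes> ((?b x y \<otimes> ?b x w) \<otimes> ?b y w)" using x y w bc by (simp add: m_assoc)
  also have "(?b x y \<otimes> ?b x w) \<otimes> ?b y w = ?b y w \<otimes> (?b x y \<otimes> ?b x w)"
    using center_commute[OF b(3), of "?b x y \<otimes> ?b x w"] bc by simp
  also have "x \<otimes> y \<otimes> w \<otimes> (?b y w \<otimes> (?b x y \<otimes> ?b x w)) = x \<otimes>\<^bsub>baer\<^esub> (y \<otimes>\<^bsub>baer\<^esub> w)"
    using x y w bc b by (simp add: baer_mult baer_cocycle_mult baer_cocycle_center m_assoc)
  finally show "x \<otimes>\<^bsub>baer\<^esub> y \<otimes>\<^bsub>baer\<^esub> w = x \<otimes>\<^bsub>baer\<^esub> (y \<otimes>\<^bsub>baer\<^esub> w)" .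
next
  fix x y assume "x \<in> carrier baer" "y \<in> carrier baer"
  then have x: "x \<in> carrier G" and y: "y \<in> carrier G" by simp_all
  let ?d = "comm x y"
  have d: "?d \<in> Z" "?d \<in> carrier G" using x y commutator_central by auto
  \<comment> \<open>By the exponent, \<open>?d [^] half\<close> is a square root of
    \<open>?d\<close>. So correcting \<open>?d\<close> by the inverse of this root leaves the root
    itself, which is the correction for the swapped product.\<close>
  have "half + half = Suc p" using two_half by simp
  then have dd: "?d = ?d [^] half \<otimes> ?d [^] half" using d exponent[of ?d] by (simp add: nat_pow_mult)
  have "?d \<otimes> inv (?d [^] half) = ?d [^] half"
    using d by (subst (1) dd) (simp add: m_assoc)
  then have e: "?d \<otimes> baer_cocycle x y = baer_cocycle y x"
    using d comm_swap[OF x y] by (simp add: baer_cocycle_def nat_pow_inv)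
  have "x \<otimes>\<^bsub>baer\<^esub> y = ?d \<otimes> (y \<otimes> x) \<otimes> baer_cocycle x y"
    using mult_eq_commutator_mult[OF x y] by (simp add: baer_mult)
  also have "\<dots> = y \<otimes> x \<otimes> (?d \<otimes> baer_cocycle x y)"
    using center_commute[OF d(1), of "y \<otimes> x"] d x y baer_cocycle_central[OF x y] by (simp add: m_assoc)
  finally show "x \<otimes>\<^bsub>baer\<^esub> y = y \<otimes>\<^bsub>baer\<^esub> x" by (simp add: e baer_mult)
next
  fix x assume "x \<in> carrier baer"
  then have x: "x \<in> carrier G" by simp
  have "comm x (inv x) = \<one>" using x by (simp add: commutator_eq_one_iff)
  then have "inv x \<otimes>\<^bsub>baer\<^esub> x = \<one>" using x by (simp add: baer_mult baer_cocycle_def)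
  then show "\<exists>y\<in>carrier baer. y \<otimes>\<^bsub>baer\<^esub> x = \<one>\<^bsub>baer\<^esub>" using x by auto
next
  have "\<one> \<in> Z" by (rule subgroup.one_closed[OF center_subgroup])
  then show "\<one>\<^bsub>baer\<^esub> \<otimes>\<^bsub>baer\<^esub> x = x" if "x \<in> carrier baer" for x
    using that by (simp add: baer_mult baer_cocycle_center)
next
  fix x y assume "x \<in> carrier baer" "y \<in> carrier baer"
  then show "x \<otimes>\<^bsub>baer\<^esub> y \<in> carrier baer"
    using baer_cocycle_central[of x y] by (simp add: baer_mult)
next
  show "\<one>\<^bsub>baer\<^esub> \<in> carrier baer" by simp
qed

interpretation baer: comm_group baer
  by (rule baer_comm_group)

lemma baer_pow: "x \<in> carrier G \<Longrightarrow> x [^]\<^bsub>baer\<^esub> (n::nat) = x [^] n"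
proof (induct n)
  case (Suc n)
  have "x \<otimes> x [^] n = x [^] n \<otimes> x" using Suc(2) nat_pow_mult[of x 1 n] nat_pow_mult[of x n 1] by simp
  then have "comm x (x [^] n) = \<one>" using Suc(2) by (simp add: commutator_eq_one_iff)
  then show ?case using Suc by (simp add: baer_mult baer_cocycle_def)
qed simp

text \<open>A subgroup contains the commutators of its elements and the powers of these, hence the
  correction factors of its products.\<close>

lemma subgroup_baer:
  assumes "subgroup H G" shows "subgroup H baer"
proof -
  interpret H: subgroup H G by fact
  show ?thesis
  proof
    fix x y assume x: "x \<in> H" and y: "y \<in> H"
    have "comm y x \<in> H" using x y by (simp add: commutator_def)
    then have "baer_cocycle x y \<in> H"
      unfolding baer_cocycle_def using subgroup_int_pow_closed[OF assms, of "comm y x" "int half"]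
      by (simp add: int_pow_int)
    then show "x \<otimes>\<^bsub>baer\<^esub> y \<in> H" using x y by (simp add: baer_mult)
    have "comm x (inv x) = \<one>" using x by (simp add: commutator_eq_one_iff)
    then have "inv x \<otimes>\<^bsub>baer\<^esub> x = \<one>\<^bsub>baer\<^esub>" using x by (simp add: baer_mult baer_cocycle_def)
    then have "inv\<^bsub>baer\<^esub> x = inv x" using x by (intro baer.inv_equality) simp_all
    then show "inv\<^bsub>baer\<^esub> x \<in> H" using x by simp
  qed (use H.subset in auto)
qed

text \<open>The linear functionals of the Baer group, expressed in terms of \<open>G\<close>, and those among them
  that are homomorphisms on \<open>G\<close>.\<close>

definition functional :: "('a \<Rightarrow> int) \<Rightarrow> bool" where
  "functional f \<longleftrightarrow> [f \<one> = 0] (mod int p) \<and> (\<forall>x\<in>carrier G. \<forall>y\<in>carrier G.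
     [f (x \<otimes> y) = f x + f y + int half * f (comm x y)] (mod int p))"

definition character :: "('a \<Rightarrow> int) \<Rightarrow> bool" where
  "character f \<longleftrightarrow> (\<forall>x\<in>carrier G. \<forall>y\<in>carrier G. [f (x \<otimes> y) = f x + f y] (mod int p))"

text \<open>A linear functional of the Baer group is translated back to \<open>G\<close>: the
  product \<open>u \<otimes> v\<close> is the Baer product of \<open>u\<close>, \<open>v\<close> and
  the central element \<open>comm u v [^] half\<close>, and Baer powers are the powers of
  \<open>G\<close>.\<close>

lemma separating_functional:
  assumes H: "subgroup H G" and x: "x \<in> carrier G" "x \<notin> H"
  obtains f where "functional f" "\<And>h. h \<in> H \<Longrightarrow> [f h = 0] (mod int p)" "[f x = 1] (mod int p)"
proof -
  obtain f where add: "\<And>u v. u \<in> carrier G \<Longrightarrow> v \<in> carrier G \<Longrightarrow> [f (u \<otimes>\<^bsub>baer\<^esub> v) = f u + f v] (mod int p)"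
    and f: "\<And>h. h \<in> H \<Longrightarrow> [f h = 0] (mod int p)" "[f x = 1] (mod int p)"
    using baer.separating_functional[OF prime_p _ subgroup_baer[OF H], of x] x exponent
    by (auto simp: baer_pow)
  have one: "[f \<one> = 0] (mod int p)" using f(1) subgroup.one_closed[OF H] by simp
  have pow: "[f (u [^] n) = int n * f u] (mod int p)" if u: "u \<in> carrier G" for u and n :: nat
  proof (induct n)
    case (Suc n)
    have "u [^] Suc n = u [^] n \<otimes>\<^bsub>baer\<^esub> u" using u baer_pow[of u n] baer_pow[of u "Suc n"] by simp
    then have "[f (u [^] Suc n) = f (u [^] n) + f u] (mod int p)" using add u by simp
    also have "[f (u [^] n) + f u = int n * f u + f u] (mod int p)" using Suc by (rule cong_add) simp
    finally show ?case by (simp add: algebra_simps)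
  qed (use one in simp)
  have "[f (u \<otimes> v) = f u + f v + int half * f (comm u v)] (mod int p)"
    if u: "u \<in> carrier G" and v: "v \<in> carrier G" for u v
  proof -
    let ?c = "comm u v [^] half"
    have c: "?c \<in> Z" using u v commutator_central center_nat_pow by simp
    have "baer_cocycle u v = inv ?c" using u v comm_swap[OF u v] by (simp add: baer_cocycle_def nat_pow_inv)
    then have "u \<otimes> v = (u \<otimes>\<^bsub>baer\<^esub> v) \<otimes> ?c" using u v by (simp add: baer_mult m_assoc)
    also have "\<dots> = (u \<otimes>\<^bsub>baer\<^esub> v) \<otimes>\<^bsub>baer\<^esub> ?c"
      using u v c baer.m_closed[of u v] by (subst (2) baer_mult) (simp add: baer_cocycle_center)
    finally have "u \<otimes> v = (u \<otimes>\<^bsub>baer\<^esub> v) \<otimes>\<^bsub>baer\<^esub> ?c" .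
    then have "[f (u \<otimes> v) = f (u \<otimes>\<^bsub>baer\<^esub> v) + f ?c] (mod int p)"
      using add[of "u \<otimes>\<^bsub>baer\<^esub> v" ?c] u v c baer.m_closed[of u v] by simp
    also have "[f (u \<otimes>\<^bsub>baer\<^esub> v) + f ?c = f u + f v + int half * f (comm u v)] (mod int p)"
      using add[OF u v] pow[of "comm u v" half] u v by (intro cong_add) simp_all
    finally show ?thesis .
  qed
  then have "functional f" using one by (simp add: functional_def)
  then show thesis using f by (rule that)
qed

end

section \<open>Characters, functionals and forms\<close>

text \<open>For deriving a congruence as an explicit linear combination of known ones: each use
  supplies the multipliers, and a ring identity remains.\<close>

lemma cong_comb1:
  fixes x y :: int
  assumes "[a = b] (mod m)" "x - y = u * (a - b)"
  shows "[x = y] (mod m)"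
  using assms by (simp add: cong_iff_dvd_diff)

lemma cong_comb2:
  fixes x y :: int
  assumes "[a = b] (mod m)" "[c = d] (mod m)" "x - y = u * (a - b) + v * (c - d)"
  shows "[x = y] (mod m)"
  using assms by (simp add: cong_iff_dvd_diff)

text \<open>For alternating \<open>w\<close> this is the exterior product of a linear and a bilinear
  form; the minus sign of the middle term is absorbed by writing \<open>w k g\<close>.\<close>

definition wedge :: "('a \<Rightarrow> int) \<Rightarrow> ('a \<Rightarrow> 'a \<Rightarrow> int) \<Rightarrow> 'a \<Rightarrow> 'a \<Rightarrow> 'a \<Rightarrow> int" where
  "wedge l w g h k = l g * w h k + l h * w k g + l k * w g h"

context class_two_group
begin

abbreviation derived_sub where "derived_sub \<equiv> derived G (carrier G)"

lemma derived_sub_eq: "derived_sub = generate G {comm x y | x y. x \<in> carrier G \<and> y \<in> carrier G}"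
  unfolding derived_def commutator_def by (rule arg_cong[where f = "generate G"]) blast

lemma comm_in_derived: "x \<in> carrier G \<Longrightarrow> y \<in> carrier G \<Longrightarrow> comm x y \<in> derived_sub"
  unfolding derived_sub_eq by (intro generate.incl) auto

lemma derived_subset_center: "derived_sub \<subseteq> Z"
  unfolding derived_sub_eq using commutator_central
  by (intro generate_subgroup_incl[OF _ center_subgroup]) auto

lemma functional_one: "functional f \<Longrightarrow> [f \<one> = 0] (mod int p)"
  by (simp add: functional_def)

lemma functional_mult:
  "functional f \<Longrightarrow> x \<in> carrier G \<Longrightarrow> y \<in> carrier G \<Longrightarrow>
    [f (x \<otimes> y) = f x + f y + int half * f (comm x y)] (mod int p)"
  by (simp add: functional_def)

lemma functional_mult_center:
  assumes f: "functional f" and x: "x \<in> carrier G" and c: "c \<in> Z"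
  shows "[f (x \<otimes> c) = f x + f c] (mod int p)" "[f (c \<otimes> x) = f c + f x] (mod int p)"
proof -
  show "[f (x \<otimes> c) = f x + f c] (mod int p)"
    by (rule cong_comb2[OF functional_mult[OF f x Z_carrier[OF c]] functional_one[OF f], of _ _ 1 "int half"])
      (use x c in simp)
  show "[f (c \<otimes> x) = f c + f x] (mod int p)"
    by (rule cong_comb2[OF functional_mult[OF f Z_carrier[OF c] x] functional_one[OF f], of _ _ 1 "int half"])
      (use x c in simp)
qed

lemma functional_diff:
  assumes f: "functional f" and g: "functional g"
  shows "functional (\<lambda>x. t * f x - g x)"
  unfolding functional_def
proof (intro conjI ballI)
  show "[t * f \<one> - g \<one> = 0] (mod int p)"
    by (rule cong_comb2[OF functional_one[OF f] functional_one[OF g], of _ _ t "-1"]) simp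
  show "[t * f (x \<otimes> y) - g (x \<otimes> y) = t * f x - g x + (t * f y - g y) + int half * (t * f (comm x y) - g (comm x y))] (mod int p)"
    if "x \<in> carrier G" "y \<in> carrier G" for x y
    by (rule cong_comb2[OF functional_mult[OF f that] functional_mult[OF g that], of _ _ t "-1"])
      (simp add: algebra_simps)
qed

lemma character_mult:
  "character f \<Longrightarrow> x \<in> carrier G \<Longrightarrow> y \<in> carrier G \<Longrightarrow> [f (x \<otimes> y) = f x + f y] (mod int p)"
  by (simp add: character_def)

lemma character_one:
  assumes "character f" shows "[f \<one> = 0] (mod int p)"
proof -
  have "[f \<one> = f \<one> + f \<one>] (mod int p)" using character_mult[OF assms, of \<one> \<one>] by simp
  then show ?thesis by (rule cong_comb1[where u = "-1"]) simp
qed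

lemma character_inv:
  assumes "character f" "x \<in> carrier G" shows "[f (inv x) = - f x] (mod int p)"
proof -
  have "[f \<one> = f (inv x) + f x] (mod int p)" using character_mult[OF assms(1), of "inv x" x] assms(2) by simp
  then show ?thesis
    by (rule cong_comb2[OF _ character_one[OF assms(1)], where u = "-1" and v = 1]) simp
qed

lemma character_zero: "character (\<lambda>x. 0)"
  by (simp add: character_def)

lemma character_scale: "character f \<Longrightarrow> character (\<lambda>x. t * f x)"
  unfolding character_def
proof (intro ballI)
  fix x y assume f: "\<forall>x\<in>carrier G. \<forall>y\<in>carrier G. [f (x \<otimes> y) = f x + f y] (mod int p)"
    and xy: "x \<in> carrier G" "y \<in> carrier G"
  have "[f (x \<otimes> y) = f x + f y] (mod int p)" using f xy by blast
  then show "[t * f (x \<otimes> y) = t * f x + t * f y] (mod int p)"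
    by (rule cong_comb1[where u = t]) (simp add: algebra_simps)
qed

lemma character_add:
  assumes f: "character f" and g: "character g" shows "character (\<lambda>x. f x + g x)"
  unfolding character_def
proof (intro ballI)
  fix x y assume xy: "x \<in> carrier G" "y \<in> carrier G"
  show "[f (x \<otimes> y) + g (x \<otimes> y) = f x + g x + (f y + g y)] (mod int p)"
    by (rule cong_comb2[OF character_mult[OF f xy] character_mult[OF g xy], where u = 1 and v = 1]) simp
qed

lemma character_sum: "(\<And>i. i \<in> I \<Longrightarrow> character (f i)) \<Longrightarrow> character (\<lambda>x. \<Sum>i\<in>I. f i x)"
  by (induct I rule: infinite_finite_induct) (simp_all add: character_zero character_add)

lemma functional_imp_character:
  assumes "functional f" "\<And>x y. x \<in> carrier G \<Longrightarrow> y \<in> carrier G \<Longrightarrow> [f (comm x y) = 0] (mod int p)"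
  shows "character f"
  unfolding character_def
proof (intro ballI)
  fix x y assume xy: "x \<in> carrier G" "y \<in> carrier G"
  show "[f (x \<otimes> y) = f x + f y] (mod int p)"
    by (rule cong_comb2[OF functional_mult[OF assms(1) xy] assms(2)[OF xy], of _ _ 1 "int half"]) simp
qed

lemma character_pow:
  assumes "character f" "x \<in> carrier G"
  shows "[f (x [^] (n::nat)) = int n * f x] (mod int p)"
proof (induct n)
  case (Suc n)
  have "[f (x [^] Suc n) = f (x [^] n) + f x] (mod int p)" using character_mult[OF assms(1)] assms(2) by simp
  then show ?case by (rule cong_comb2[OF _ Suc, where u = 1 and v = 1]) (simp add: algebra_simps)
qed (use character_one[OF assms(1)] in simp)

lemma character_eq_zeroI:
  assumes f: "character f" and gen: "generate G T = carrier G" and T: "T \<subseteq> carrier G"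
    and zero: "\<And>t. t \<in> T \<Longrightarrow> [f t = 0] (mod int p)" and x: "x \<in> carrier G"
  shows "[f x = 0] (mod int p)"
proof -
  have "x \<in> generate G T" using x gen by simp
  then show ?thesis
  proof induct
    case one then show ?case by (rule character_one[OF f])
  next
    case (incl h) then show ?case by (rule zero)
  next
    case (inv h)
    then show ?case using T zero
      by (intro cong_comb2[OF character_inv[OF f, of h] zero[of h], of _ _ 1 "-1"]) auto
  next
    case (eng g h)
    then have "g \<in> carrier G" "h \<in> carrier G" using gen by auto
    note m = character_mult[OF f this]
    have "[f g + f h = 0 + 0] (mod int p)" using eng by (intro cong_add)
    then show ?case using m by (simp add: cong_trans)
  qed
qed

text \<open>The deviation of a functional from additivity on \<open>G\<close>. Modulo
  \<open>p\<close> it is an alternating bilinear form that vanishes on the center, hence a form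
  \<omega> on the quotient by the center.\<close>

definition form :: "('a \<Rightarrow> int) \<Rightarrow> 'a \<Rightarrow> 'a \<Rightarrow> int" where
  "form f x y = int half * f (comm x y)"

lemma form_eq_zero:
  assumes "functional f" "comm x y = \<one>" shows "[form f x y = 0] (mod int p)"
  unfolding form_def assms(2) by (rule cong_comb1[OF functional_one[OF assms(1)], where u = "int half"]) simp

lemma form_center:
  assumes "functional f" "c \<in> Z" "x \<in> carrier G"
  shows "[form f c x = 0] (mod int p)" "[form f x c = 0] (mod int p)"
  using assms by (simp_all add: form_eq_zero)

lemma form_mult:
  assumes f: "functional f" and x: "x \<in> carrier G" and y: "y \<in> carrier G" and w: "w \<in> carrier G"
  shows "[form f (x \<otimes> y) w = form f x w + form f y w] (mod int p)"
    and "[form f w (x \<otimes> y) = form f w x + form f w y] (mod int p)"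
proof -
  have "[f (comm x w \<otimes> comm y w) = f (comm x w) + f (comm y w)] (mod int p)"
    "[f (comm w x \<otimes> comm w y) = f (comm w x) + f (comm w y)] (mod int p)"
    using f x y w commutator_central by (simp_all add: functional_mult_center)
  note c = this
  show "[form f (x \<otimes> y) w = form f x w + form f y w] (mod int p)"
    unfolding form_def comm_mult_left[OF x y w]
    by (rule cong_comb1[OF c(1), where u = "int half"]) (simp add: algebra_simps)
  show "[form f w (x \<otimes> y) = form f w x + form f w y] (mod int p)"
    unfolding form_def comm_mult_right[OF x y w]
    by (rule cong_comb1[OF c(2), where u = "int half"]) (simp add: algebra_simps)
qed

lemma form_character:
  assumes "functional f" "w \<in> carrier G"
  shows "character (\<lambda>x. form f x w)" "character (form f w)"
  using assms form_mult by (auto simp: character_def)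

lemma form_self:
  assumes "functional f" "x \<in> carrier G" shows "[form f x x = 0] (mod int p)"
  using assms by (simp add: form_eq_zero)

lemma form_swap:
  assumes "functional f" "x \<in> carrier G" "y \<in> carrier G"
  shows "[form f x y = - form f y x] (mod int p)"
proof -
  have "comm x y \<otimes> comm y x = \<one>" using assms comm_swap[of x y] by simp
  then have "[f \<one> = f (comm x y) + f (comm y x)] (mod int p)"
    using functional_mult_center(1)[OF assms(1), of "comm x y" "comm y x"] assms commutator_central by simp
  then show ?thesis unfolding form_def
    by (rule cong_comb2[OF _ functional_one[OF assms(1)], where u = "- int half" and v = "int half"])
      (simp add: algebra_simps)
qed

text \<open>For \<open>\<omega> = a \<and> b + a' \<and> y\<close> and \<open>\<omega>' = - a \<and> y + a' \<and> y'\<close> the tensor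
  \<open>a \<otimes> \<omega> - a' \<otimes> \<omega>'\<close> is a sum of tensors \<open>r \<otimes> (r \<and> s)\<close> and polarisations
  of these.  Each such tensor is the coboundary of an explicit cubic polynomial, without
  division by \<open>3\<close>; the terms of \<open>cubic\<close> not involving \<open>L\<close> and \<open>L'\<close> are these polynomials.\<close>

definition cubic :: "int \<Rightarrow> int \<Rightarrow> int \<Rightarrow> int \<Rightarrow> int \<Rightarrow> int \<Rightarrow> int \<Rightarrow> int \<Rightarrow> int \<Rightarrow> int \<Rightarrow> int \<Rightarrow> int \<Rightarrow> int" where
  "cubic a a' b y y' A A' B Y Y' L L' = 2*a*L - 2*a'*L' + a*a*B - 2*a*b*A - b*A*A
     + 2*a*a'*Y - 2*(a*y*A' + a'*y*A) - 2*y*A*A' - a'*a'*Y' + 2*a'*y'*A' + y'*A'*A'"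

lemma cubic_cong:
  assumes "[a = a1] (mod m)" "[a' = a1'] (mod m)" "[b = b1] (mod m)" "[y = y1] (mod m)" "[y' = y1'] (mod m)"
    "[A = A1] (mod m)" "[A' = A1'] (mod m)" "[B = B1] (mod m)" "[Y = Y1] (mod m)" "[Y' = Y1'] (mod m)"
    "[L = L1] (mod m)" "[L' = L1'] (mod m)"
  shows "[cubic a a' b y y' A A' B Y Y' L L' = cubic a1 a1' b1 y1 y1' A1 A1' B1 Y1 Y1' L1 L1'] (mod m)"
  unfolding cubic_def using assms by (intro cong_add cong_diff cong_mult cong_refl)

text \<open>The cocycle identity for elements \<open>g\<close>, \<open>h\<close>, \<open>k\<close>
  as an identity of integer polynomials: \<open>a, ..., y'\<close> are values at \<open>g\<close>,
  \<open>A, ..., L'\<close> at \<open>h\<close>, and \<open>c, ..., m'\<close> at \<open>k\<close>.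
  The long last two arguments are the values of the two functionals at
  \<open>h \<otimes> k\<close>.\<close>

lemma cubic_cocycle:
  "cubic a a' b y y' A A' B Y Y' L L'
     + cubic (a + A) (a' + A') (b + B) (y + Y) (y' + Y') c c' d u u' m m'
   = cubic A A' B Y Y' c c' d u u' m m'
     + cubic a a' b y y' (A + c) (A' + c') (B + d) (Y + u) (Y' + u')
         (L + m + (A * d - c * B + (A' * u - c' * Y)))
         (L' + m' + (- (A * u - c * Y) + (A' * u' - c' * Y')))"
  unfolding cubic_def
  by (simp only: ring_distribs mult_ac add_ac diff_conv_add_uminus minus_add_distrib
      mult_minus_left mult_minus_right minus_minus)

text \<open>All characters involved vanish at \<open>z\<close>, and so does \<open>l'\<close>. Thus
  the cocycle built from \<open>cubic\<close> is 0 at \<open>(z, h)\<close> and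
  \<open>2 * a h * l z\<close> at \<open>(h, z)\<close>, and the latter is nonzero because
  \<open>p\<close> is odd. The shapes of the two forms are those for which
  \<open>cubic_cocycle\<close> closes up.\<close>

lemma cocycle_exists:
  assumes ch: "character a" "character a'" "character b" "character y" "character y'"
    and l: "functional l" "functional l'"
    and w: "\<And>g h. g \<in> carrier G \<Longrightarrow> h \<in> carrier G \<Longrightarrow>
      [form l g h = a g * b h - a h * b g + (a' g * y h - a' h * y g)] (mod int p)"
    and w': "\<And>g h. g \<in> carrier G \<Longrightarrow> h \<in> carrier G \<Longrightarrow>
      [form l' g h = - (a g * y h - a h * y g) + (a' g * y' h - a' h * y' g)] (mod int p)"
    and z: "z \<in> Z" "[a z = 0] (mod int p)" "[a' z = 0] (mod int p)" "[b z = 0] (mod int p)"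
      "[y z = 0] (mod int p)" "[y' z = 0] (mod int p)"
    and lz: "\<not> [l z = 0] (mod int p)" "[l' z = 0] (mod int p)"
    and h: "h \<in> carrier G" "\<not> [a h = 0] (mod int p)"
  shows "\<exists>f. normalized_cocycle G (int p) f \<and> (\<exists>h\<in>carrier G. \<not> [f z h = f h z] (mod int p))"
proof -
  define f where "f g h = cubic (a g) (a' g) (b g) (y g) (y' g) (a h) (a' h) (b h) (y h) (y' h) (l h) (l' h)" for g h
  have one: "[a \<one> = 0] (mod int p)" "[a' \<one> = 0] (mod int p)" "[b \<one> = 0] (mod int p)"
    "[y \<one> = 0] (mod int p)" "[y' \<one> = 0] (mod int p)" "[l \<one> = 0] (mod int p)" "[l' \<one> = 0] (mod int p)"
    using ch l by (simp_all add: character_one functional_one)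
  have lm: "[l (g \<otimes> h) = l g + l h + (a g * b h - a h * b g + (a' g * y h - a' h * y g))] (mod int p)"
    "[l' (g \<otimes> h) = l' g + l' h + (- (a g * y h - a h * y g) + (a' g * y' h - a' h * y' g))] (mod int p)"
    if "g \<in> carrier G" "h \<in> carrier G" for g h
    using cong_comb2[OF functional_mult[OF l(1) that] w[OF that], of _ _ 1 1]
      cong_comb2[OF functional_mult[OF l(2) that] w'[OF that], of _ _ 1 1]
    by (simp_all add: form_def)
  have "normalized_cocycle G (int p) f"
    unfolding normalized_cocycle_def
  proof (intro conjI ballI)
    fix g assume g: "g \<in> carrier G"
    have "[f g \<one> = cubic (a g) (a' g) (b g) (y g) (y' g) 0 0 0 0 0 0 0] (mod int p)"
      unfolding f_def by (intro cubic_cong one cong_refl)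
    then show "[f g \<one> = 0] (mod int p)" by (simp add: cubic_def)
    have "[f \<one> g = cubic 0 0 0 0 0 (a g) (a' g) (b g) (y g) (y' g) (l g) (l' g)] (mod int p)"
      unfolding f_def by (intro cubic_cong one cong_refl)
    then show "[f \<one> g = 0] (mod int p)" by (simp add: cubic_def)
  next
    fix g h k assume g: "g \<in> carrier G" and h: "h \<in> carrier G" and k: "k \<in> carrier G"
    let ?l = "l h + l k + (a h * b k - a k * b h + (a' h * y k - a' k * y h))"
    let ?l' = "l' h + l' k + (- (a h * y k - a k * y h) + (a' h * y' k - a' k * y' h))"
    have "[f g h + f (g \<otimes> h) k = f g h + cubic (a g + a h) (a' g + a' h) (b g + b h) (y g + y h) (y' g + y' h)
        (a k) (a' k) (b k) (y k) (y' k) (l k) (l' k)] (mod int p)"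
      unfolding f_def using ch g h by (intro cubic_cong cong_add cong_refl character_mult)
    also have "f g h + cubic (a g + a h) (a' g + a' h) (b g + b h) (y g + y h) (y' g + y' h)
        (a k) (a' k) (b k) (y k) (y' k) (l k) (l' k)
      = f h k + cubic (a g) (a' g) (b g) (y g) (y' g) (a h + a k) (a' h + a' k) (b h + b k) (y h + y k)
        (y' h + y' k) ?l ?l'"
      unfolding f_def by (rule cubic_cocycle)
    also have "[\<dots> = f h k + f g (h \<otimes> k)] (mod int p)"
      unfolding f_def using ch h k lm[OF h k]
      by (intro cubic_cong cong_add[OF cong_refl] cong_refl cong_sym[OF character_mult] cong_sym[OF lm(1)] cong_sym[OF lm(2)])
    finally show "[f g h + f (g \<otimes> h) k = f h k + f g (h \<otimes> k)] (mod int p)" .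
  qed
  moreover have "\<not> [f z h = f h z] (mod int p)"
  proof
    assume e: "[f z h = f h z] (mod int p)"
    have "[f z h = cubic 0 0 0 0 0 (a h) (a' h) (b h) (y h) (y' h) (l h) (l' h)] (mod int p)"
      unfolding f_def by (intro cubic_cong z cong_refl)
    then have e1: "[f z h = 0] (mod int p)" by (simp add: cubic_def)
    have "[f h z = cubic (a h) (a' h) (b h) (y h) (y' h) 0 0 0 0 0 (l z) 0] (mod int p)"
      unfolding f_def by (intro cubic_cong z lz cong_refl)
    then have e2: "[f h z = 2 * a h * l z] (mod int p)" by (simp add: cubic_def)
    have "[2 * a h * l z = 0] (mod int p)"
      using cong_trans[OF cong_sym[OF e2] cong_trans[OF cong_sym[OF e] e1]] .
    then have "int p dvd 2 * a h * l z" by (simp add: cong_0_iff)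
    moreover have "Factorial_Ring.prime (int p)" using prime_p by (simp add: prime_nat_int_transfer)
    moreover have "\<not> int p dvd 2"
    proof
      assume "int p dvd 2"
      then have "p dvd 2" by (metis int_dvd_int_iff of_nat_numeral)
      then have "p \<le> 2" by (rule dvd_imp_le) simp
      then show False using prime_p odd_p prime_ge_2_nat[of p] by auto
    qed
    ultimately show False using h lz by (auto simp: prime_dvd_mult_iff cong_0_iff)
  qed
  ultimately show ?thesis using h by blast
qed

end

section \<open>Cocycles from linear relations between forms\<close>

text \<open>The dimension of the space of alternating trilinear forms in dimension \<open>n\<close>,
  namely 0, 1, 4 for \<open>n\<close> = 2, 3, 4. It never exceeds \<open>n\<close> and reaches
  \<open>n\<close> only at 4.\<close>

lemma card_increasing_triples:
  assumes "2 \<le> n" "n \<le> 4"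
  defines "T \<equiv> {(i, j, l). i < j \<and> j < l \<and> l < (n :: nat)}"
  shows "finite T" "card T \<le> n" "n \<noteq> 4 \<Longrightarrow> card T < n" "n = 4 \<Longrightarrow> card T = 4"
proof -
  consider "n = 2" | "n = 3" | "n = 4" using assms(1,2) by linarith
  then have "finite T \<and> card T \<le> n \<and> (n \<noteq> 4 \<longrightarrow> card T < n) \<and> (n = 4 \<longrightarrow> card T = 4)"
  proof cases
    case 1
    then have "T = {}" by (auto simp: T_def)
    then show ?thesis using 1 by simp
  next
    case 2
    then have "T = {(0, 1, 2)}" by (auto simp: T_def)
    then show ?thesis using 2 by simp
  next
    case 3
    then have "T = {(0, 1, 2), (0, 1, 3), (0, 2, 3), (1, 2, 3)}" by (auto simp: T_def)
    then show ?thesis using 3 by simp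
  qed
  then show "finite T" "card T \<le> n" "n \<noteq> 4 \<Longrightarrow> card T < n" "n = 4 \<Longrightarrow> card T = 4" by auto
qed

section \<open>Linear forms on the central quotient and wedge relations\<close>

context class_two_group
begin

text \<open>The characters with this property are the linear forms on the quotient by the
  center.\<close>

definition kills_center :: "('a \<Rightarrow> int) \<Rightarrow> bool" where
  "kills_center f \<longleftrightarrow> (\<forall>c\<in>Z. [f c = 0] (mod int p))"

text \<open>One group element realizes the linear combination for all characters at once; the
  coefficients are reduced modulo \<open>p\<close> to obtain natural exponents.\<close>

lemma character_combination:
  assumes u: "u \<in> carrier G" and v: "v \<in> carrier G"
  obtains w where "w \<in> carrier G" "\<And>f. character f \<Longrightarrow> [f w = s * f u + t * f v] (mod int p)"
proof (rule that)
  let ?n = "\<lambda>s. nat (s mod int p)"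
  have p0: "0 < int p" using prime_p prime_gt_0_nat by simp
  have n: "[int (?n s) = s] (mod int p)" for s using p0 by (simp add: cong_def)
  let ?w = "u [^] ?n s \<otimes> v [^] ?n t"
  show "?w \<in> carrier G" using u v by simp
  fix f assume f: "character f"
  have "[f ?w = f (u [^] ?n s) + f (v [^] ?n t)] (mod int p)" using f u v by (simp add: character_mult)
  also have "[f (u [^] ?n s) + f (v [^] ?n t) = int (?n s) * f u + int (?n t) * f v] (mod int p)"
    using f u v by (intro cong_add character_pow)
  also have "[int (?n s) * f u + int (?n t) * f v = s * f u + t * f v] (mod int p)"
    by (intro cong_add cong_mult n cong_refl)
  finally show "[f ?w = s * f u + t * f v] (mod int p)" .
qed

text \<open>Contracting \<open>l\<close> \<and> \<omega> = 0 with \<open>g0\<close> and dividing by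
  \<open>l g0\<close> gives \<omega> = \<open>l\<close> \<and> \<open>b\<close>. So
  \<open>cocycle_exists\<close> applies with \<open>a = l\<close> and the other characters and the
  second functional zero.\<close>

lemma decomposable_case:
  assumes l: "character l" "kills_center l" and g0: "g0 \<in> carrier G" "\<not> [l g0 = 0] (mod int p)"
    and f: "functional f" and z: "z \<in> Z" "\<not> [f z = 0] (mod int p)"
    and wedge: "\<And>g h k. g \<in> carrier G \<Longrightarrow> h \<in> carrier G \<Longrightarrow> k \<in> carrier G \<Longrightarrow>
      [wedge l (form f) g h k = 0] (mod int p)"
  shows "\<exists>f. normalized_cocycle G (int p) f \<and> (\<exists>h\<in>carrier G. \<not> [f z h = f h z] (mod int p))"
proof -
  obtain j where j: "[l g0 * j = 1] (mod int p)" using prime_inverse_cong[OF prime_p g0(2)] .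
  define b where "b k = j * form f g0 k" for k
  have b: "character b" unfolding b_def using f g0 by (intro character_scale form_character)
  have w: "[form f g h = l g * b h - l h * b g] (mod int p)" if g: "g \<in> carrier G" and h: "h \<in> carrier G" for g h
  proof -
    have "[wedge l (form f) g0 g h = l g0 * form f g h + l g * - form f g0 h + l h * form f g0 g] (mod int p)"
      unfolding wedge_def using f g0 g h by (intro cong_add cong_mult cong_refl form_swap)
    then have e: "[l g0 * form f g h + l g * - form f g0 h + l h * form f g0 g = 0] (mod int p)"
      using wedge[OF g0(1) g h] by (meson cong_sym cong_trans)
    show ?thesis
      by (rule cong_comb2[OF e j, where u = j and v = "- form f g h"]) (simp add: b_def algebra_simps)
  qed
  have fz: "functional (\<lambda>x. 0)" by (simp add: functional_def)
  show ?thesis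
    by (rule cocycle_exists[OF l(1) character_zero b character_zero character_zero f fz _ _ z(1) _ _ _ _ _ z(2) _ g0])
      (use w z l f g0 in \<open>auto simp: kills_center_def form_def b_def
        intro: cong_comb1[OF form_center(2)[OF f z(1) g0(1)], where u = j, unfolded form_def]\<close>)
qed

text \<open>If \<open>a = t * a'\<close>, the relation says that \<open>a'\<close> annihilates the
  form of \<open>t * f - f'\<close>, whose value at \<open>z\<close> is \<open>t\<close>, and
  \<open>decomposable_case\<close> applies. If \<open>a\<close> and \<open>a'\<close> are
  independent, contractions of the relation bring both forms into the shape required by
  \<open>cocycle_exists\<close>.\<close>

lemma pencil_case:
  assumes a: "character a" "kills_center a" and g0: "g0 \<in> carrier G" "\<not> [a g0 = 0] (mod int p)"
    and a': "character a'" "kills_center a'" and x: "x \<in> carrier G" "[a' x = 1] (mod int p)"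
    and f: "functional f" and f': "functional f'" and z: "z \<in> Z" "[f z = 1] (mod int p)" "[f' z = 0] (mod int p)"
    and wedge: "\<And>g h k. g \<in> carrier G \<Longrightarrow> h \<in> carrier G \<Longrightarrow> k \<in> carrier G \<Longrightarrow>
      [wedge a (form f) g h k = wedge a' (form f') g h k] (mod int p)"
  shows "\<exists>f. normalized_cocycle G (int p) f \<and> (\<exists>h\<in>carrier G. \<not> [f z h = f h z] (mod int p))"
proof -
  have p1: "int p > 1" using prime_p prime_gt_1_nat by simp
  then have one: "\<not> [1 = 0] (mod int p)" by (simp add: cong_def)
  \<comment> \<open>As \<open>a' x\<close> is 1, this is the only possible factor of
    proportionality.\<close>
  define t where "t = a x"
  show ?thesis
  proof (cases "\<forall>g\<in>carrier G. [a g = t * a' g] (mod int p)")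
    case True
    then have t: "[a g = t * a' g] (mod int p)" if "g \<in> carrier G" for g using that by blast
    have t0: "\<not> [t = 0] (mod int p)"
    proof
      assume "[t = 0] (mod int p)"
      then have "[t * a' g0 = 0 * a' g0] (mod int p)" by (rule cong_mult) simp
      then show False using t[OF g0(1)] g0(2) by (simp add: cong_trans)
    qed
    show ?thesis
    proof (rule decomposable_case[OF a' x(1) _ functional_diff[OF f f', of t] z(1)])
      show "\<not> [a' x = 0] (mod int p)" using x(2) one by (meson cong_sym cong_trans)
      have "[t * f z - f' z = t * 1 - 0] (mod int p)" using z by (intro cong_diff cong_mult cong_refl)
      then show "\<not> [t * f z - f' z = 0] (mod int p)" using t0 by (simp add: cong_def)
      fix g h k assume ghk: "g \<in> carrier G" "h \<in> carrier G" "k \<in> carrier G"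
      have "[wedge a (form f) g h k = wedge (\<lambda>g. t * a' g) (form f) g h k] (mod int p)"
        unfolding wedge_def using ghk t by (intro cong_add cong_mult cong_refl)
      then have "[wedge a' (form f') g h k = wedge (\<lambda>g. t * a' g) (form f) g h k] (mod int p)"
        using wedge[OF ghk] by (meson cong_sym cong_trans)
      then show "[wedge a' (form (\<lambda>x. t * f x - f' x)) g h k = 0] (mod int p)"
        by (rule cong_comb1[where u = "-1"]) (simp add: wedge_def form_def algebra_simps)
    qed
  next
    case False
    then obtain g where g: "g \<in> carrier G" "\<not> [a g = t * a' g] (mod int p)" by blast
    then have "\<not> [a g - t * a' g = 0] (mod int p)" by (simp add: cong_diff_iff_cong_0)
    then obtain j where j: "[(a g - t * a' g) * j = 1] (mod int p)" by (rule prime_inverse_cong[OF prime_p])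
    \<comment> \<open>Written additively, \<open>h0\<close> is \<open>j * (g - a' g * x)\<close>
      and, below, \<open>h1\<close> is \<open>x - t * h0\<close>. They are dual to \<open>a\<close>
      and \<open>a'\<close>.\<close>
    obtain h0 where h0: "h0 \<in> carrier G" and
      h0c: "\<And>f. character f \<Longrightarrow> [f h0 = j * f g + (- j * a' g) * f x] (mod int p)"
      using character_combination[OF g(1) x(1), of j "- j * a' g"] by metis
    have ah0: "[a h0 = 1] (mod int p)"
      by (rule cong_comb2[OF h0c[OF a(1)] j, where u = 1 and v = 1]) (simp add: t_def algebra_simps)
    have a'h0: "[a' h0 = 0] (mod int p)"
      by (rule cong_comb2[OF h0c[OF a'(1)] x(2), where u = 1 and v = "- j * a' g"]) (simp add: algebra_simps)
    obtain h1 where h1: "h1 \<in> carrier G" and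
      h1c: "\<And>f. character f \<Longrightarrow> [f h1 = 1 * f x + (- t) * f h0] (mod int p)"
      using character_combination[OF x(1) h0, of 1 "- t"] by metis
    have ah1: "[a h1 = 0] (mod int p)"
      by (rule cong_comb2[OF h1c[OF a(1)] ah0, where u = 1 and v = "- t"]) (simp add: t_def algebra_simps)
    have a'h1: "[a' h1 = 1] (mod int p)"
    proof -
      have "[1 * a' x + (- t) * a' h0 = 1 * 1 + (- t) * 0] (mod int p)"
        using x(2) a'h0 by (intro cong_add cong_mult cong_refl)
      then show ?thesis using h1c[OF a'(1)] by (simp add: cong_trans)
    qed
    let ?X = "form f h0" and ?X' = "form f' h0" and ?Y = "form f h1" and ?Y' = "form f' h1"
    have chars: "character ?X" "character ?X'" "character ?Y" "character ?Y'"
      using f f' h0 h1 by (simp_all add: form_character)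
    \<comment> \<open>\<open>E1\<close> is the relation contracted with \<open>h0\<close>, and
      \<open>E2\<close> the one contracted with \<open>h1\<close>.\<close>
    have E1: "[form f h k = a h * ?X k - a k * ?X h - a' h * ?X' k + a' k * ?X' h] (mod int p)"
      if h: "h \<in> carrier G" and k: "k \<in> carrier G" for h k
    proof -
      have "[wedge a (form f) h0 h k = 1 * form f h k + a h * - ?X k + a k * ?X h] (mod int p)"
        unfolding wedge_def using f h0 h k ah0 by (intro cong_add cong_mult cong_refl form_swap)
      moreover have "[wedge a' (form f') h0 h k = 0 * form f' h k + a' h * - ?X' k + a' k * ?X' h] (mod int p)"
        unfolding wedge_def using f' h0 h k a'h0 by (intro cong_add cong_mult cong_refl form_swap)
      ultimately have "[1 * form f h k + a h * - ?X k + a k * ?X h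
          = 0 * form f' h k + a' h * - ?X' k + a' k * ?X' h] (mod int p)"
        using wedge[OF h0 h k] by (meson cong_sym cong_trans)
      then show ?thesis by (rule cong_comb1[where u = 1]) simp
    qed
    have E2: "[form f' h k = - (a h * ?Y k - a k * ?Y h) + (a' h * ?Y' k - a' k * ?Y' h)] (mod int p)"
      if h: "h \<in> carrier G" and k: "k \<in> carrier G" for h k
    proof -
      have "[wedge a (form f) h1 h k = 0 * form f h k + a h * - ?Y k + a k * ?Y h] (mod int p)"
        unfolding wedge_def using f h1 h k ah1 by (intro cong_add cong_mult cong_refl form_swap)
      moreover have "[wedge a' (form f') h1 h k = 1 * form f' h k + a' h * - ?Y' k + a' k * ?Y' h] (mod int p)"
        unfolding wedge_def using f' h1 h k a'h1 by (intro cong_add cong_mult cong_refl form_swap)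
      ultimately have "[0 * form f h k + a h * - ?Y k + a k * ?Y h
          = 1 * form f' h k + a' h * - ?Y' k + a' k * ?Y' h] (mod int p)"
        using wedge[OF h1 h k] by (meson cong_sym cong_trans)
      then show ?thesis by (rule cong_comb1[where u = "-1"]) simp
    qed
    \<comment> \<open>Evaluating \<open>E2\<close> at \<open>h0\<close> expresses \<open>?X'\<close>
      by \<open>?Y\<close>, \<open>a\<close> and \<open>a'\<close>. Substituted into
      \<open>E1\<close>, it turns the term with \<open>?X'\<close> into \<open>a'\<close> \<and>
      \<open>?Y\<close> plus a multiple of \<open>a\<close> \<and> \<open>a'\<close>; the latter is
      absorbed into \<open>b\<close>.\<close>
    have X': "[?X' k = - (1 * ?Y k - a k * ?Y h0) + (0 * ?Y' k - a' k * ?Y' h0)] (mod int p)"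
      if k: "k \<in> carrier G" for k
    proof -
      have "[- (a h0 * ?Y k - a k * ?Y h0) + (a' h0 * ?Y' k - a' k * ?Y' h0)
         = - (1 * ?Y k - a k * ?Y h0) + (0 * ?Y' k - a' k * ?Y' h0)] (mod int p)"
        using ah0 a'h0 by (intro cong_add cong_diff cong_mult cong_refl cong_minus_minus_iff[THEN iffD2])
      then show ?thesis using E2[OF h0 k] by (rule cong_trans[rotated])
    qed
    define b where "b k = ?X k + ?Y h0 * a' k" for k
    have b: "character b" unfolding b_def using chars a' by (intro character_add character_scale)
    have w: "[form f h k = a h * b k - a k * b h + (a' h * ?Y k - a' k * ?Y h)] (mod int p)"
      if h: "h \<in> carrier G" and k: "k \<in> carrier G" for h k
    proof -
      have "[a h * ?X k - a k * ?X h - a' h * ?X' k + a' k * ?X' h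
        = a h * ?X k - a k * ?X h - a' h * (- (1 * ?Y k - a k * ?Y h0) + (0 * ?Y' k - a' k * ?Y' h0))
          + a' k * (- (1 * ?Y h - a h * ?Y h0) + (0 * ?Y' h - a' h * ?Y' h0))] (mod int p)"
        using X' h k by (intro cong_add cong_diff cong_mult cong_refl)
      then have "[form f h k = a h * ?X k - a k * ?X h - a' h * (- (1 * ?Y k - a k * ?Y h0) + (0 * ?Y' k - a' k * ?Y' h0))
          + a' k * (- (1 * ?Y h - a h * ?Y h0) + (0 * ?Y' h - a' h * ?Y' h0))] (mod int p)"
        by (rule cong_trans[OF E1[OF h k]])
      then show ?thesis by (rule cong_comb1[where u = 1]) (simp add: b_def algebra_simps)
    qed
    show ?thesis
    proof (rule cocycle_exists[OF a(1) a'(1) b chars(3,4) f f' w E2 z(1) _ _ _ _ _ _ z(3) g0])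
      show "[a z = 0] (mod int p)" "[a' z = 0] (mod int p)" using a a' z by (auto simp: kills_center_def)
      then have "[?X z + ?Y h0 * a' z = 0 + ?Y h0 * 0] (mod int p)"
        using f h0 z by (intro cong_add cong_mult cong_refl form_center)
      then show "[b z = 0] (mod int p)" by (simp add: b_def)
      show "[?Y z = 0] (mod int p)" "[?Y' z = 0] (mod int p)" using f f' h1 z by (simp_all add: form_center)
      show "\<not> [f z = 0] (mod int p)" using z(2) one by (meson cong_sym cong_trans)
    qed
  qed
qed

text \<open>If the form vanished, then, 2 being invertible, \<open>f\<close> would vanish on
  commutators, so be a character and vanish on the whole derived subgroup.\<close>

lemma form_nonzero:
  assumes f: "functional f" and z: "z \<in> derived_sub" "\<not> [f z = 0] (mod int p)"
  shows "\<exists>g\<in>carrier G. \<exists>h\<in>carrier G. \<not> [form f g h = 0] (mod int p)"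
proof (rule ccontr)
  assume "\<not> ?thesis"
  then have form: "[form f g h = 0] (mod int p)" if "g \<in> carrier G" "h \<in> carrier G" for g h using that by blast
  have com: "[f (comm g h) = 0] (mod int p)" if gh: "g \<in> carrier G" "h \<in> carrier G" for g h
    by (rule cong_comb2[OF form[OF gh] two_half_cong, where u = 2 and v = "- f (comm g h)"])
      (simp add: form_def algebra_simps)
  have ch: "character f" using f com by (rule functional_imp_character)
  have "[f z = 0] (mod int p)" using z(1) unfolding derived_sub_eq
  proof (induct rule: generate.induct)
    case one then show ?case by (rule character_one[OF ch])
  next
    case (incl h) then show ?case using com by auto
  next
    case (inv h)
    then have h: "h \<in> carrier G" "[f h = 0] (mod int p)" using com by auto
    show ?case by (rule cong_comb2[OF character_inv[OF ch h(1)] h(2), where u = 1 and v = "-1"]) simp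
  next
    case (eng g h)
    then have gh: "g \<in> carrier G" "h \<in> carrier G"
      using derived_subset_center unfolding derived_sub_eq by auto
    have "[f g + f h = 0 + 0] (mod int p)" using eng by (intro cong_add)
    then show ?case using character_mult[OF ch gh] by (simp add: cong_trans)
  qed
  then show False using z(2) by simp
qed

lemma separating_character:
  assumes "subgroup H G" "derived_sub \<subseteq> H" "x \<in> carrier G" "x \<notin> H"
  obtains f where "character f" "\<And>h. h \<in> H \<Longrightarrow> [f h = 0] (mod int p)" "[f x = 1] (mod int p)"
proof -
  obtain f where f: "functional f" "\<And>h. h \<in> H \<Longrightarrow> [f h = 0] (mod int p)" "[f x = 1] (mod int p)"
    using separating_functional assms by metis
  have "character f" using f(2) assms(2) comm_in_derived by (intro functional_imp_character[OF f(1)]) blast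
  then show thesis using f that by blast
qed

lemma functional_pow:
  assumes f: "functional f" and x: "x \<in> carrier G"
  shows "[f (x [^] (n::nat)) = int n * f x] (mod int p)"
proof (induct n)
  case (Suc n)
  have "x \<otimes> x [^] n = x [^] n \<otimes> x" using x nat_pow_mult[of x 1 n] nat_pow_mult[of x n 1] by simp
  then have c: "comm (x [^] n) x = \<one>" using x by (simp add: commutator_eq_one_iff)
  have "[f (x [^] n \<otimes> x) = f (x [^] n) + f x + int half * f \<one>] (mod int p)"
    using functional_mult[OF f, of "x [^] n" x] x by (simp add: c)
  also have "[f (x [^] n) + f x + int half * f \<one> = int n * f x + f x + int half * 0] (mod int p)"
    using functional_one[OF f] Suc by (intro cong_add cong_mult cong_refl)
  finally show ?case by (simp add: algebra_simps)
qed (use functional_one[OF f] in simp)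

text \<open>Alternating trilinear forms on the central quotient. Linearity is demanded in the first
  argument only; cyclic symmetry carries it to the others.\<close>

definition alternating3 :: "('a \<Rightarrow> 'a \<Rightarrow> 'a \<Rightarrow> int) \<Rightarrow> bool" where
  "alternating3 t \<longleftrightarrow>
     (\<forall>h\<in>carrier G. \<forall>k\<in>carrier G. character (\<lambda>g. t g h k) \<and> kills_center (\<lambda>g. t g h k)) \<and>
     (\<forall>g\<in>carrier G. \<forall>h\<in>carrier G. \<forall>k\<in>carrier G. [t g h k = t h k g] (mod int p) \<and>
        [t g h k = - t h g k] (mod int p) \<and> [t g g k = 0] (mod int p))"

lemma alternating3_wedge:
  assumes l: "character l" "kills_center l" and f: "functional f"
  shows "alternating3 (wedge l (form f))"
  unfolding alternating3_def
proof (intro conjI ballI)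
  fix h k assume h: "h \<in> carrier G" and k: "k \<in> carrier G"
  have "character (\<lambda>g. form f h k * l g + l h * form f k g + l k * form f g h)"
    using l f h k by (intro character_add character_scale form_character)
  then show "character (\<lambda>g. wedge l (form f) g h k)" by (simp add: wedge_def mult.commute)
  show "kills_center (\<lambda>g. wedge l (form f) g h k)"
    unfolding kills_center_def
  proof
    fix c assume c: "c \<in> Z"
    have "[wedge l (form f) c h k = 0 * form f h k + l h * 0 + l k * 0] (mod int p)"
      unfolding wedge_def using l f c h k
      by (intro cong_add cong_mult cong_refl form_center) (auto simp: kills_center_def)
    then show "[wedge l (form f) c h k = 0] (mod int p)" by simp
  qed
next
  fix g h k assume g: "g \<in> carrier G" and h: "h \<in> carrier G" and k: "k \<in> carrier G"
  show "[wedge l (form f) g h k = wedge l (form f) h k g] (mod int p)" by (simp add: wedge_def add_ac)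
  have "[wedge l (form f) g h k = l g * - form f k h + l h * - form f g k + l k * - form f h g] (mod int p)"
    unfolding wedge_def using f g h k by (intro cong_add cong_mult cong_refl form_swap)
  then show "[wedge l (form f) g h k = - wedge l (form f) h g k] (mod int p)"
    by (simp add: wedge_def algebra_simps)
  have "[wedge l (form f) g g k = l g * form f g k + l g * - form f g k + l k * 0] (mod int p)"
    unfolding wedge_def using f g k by (intro cong_add cong_mult cong_refl form_swap form_self)
  then show "[wedge l (form f) g g k = 0] (mod int p)" by simp
qed

lemma alternating3_diff:
  assumes s: "alternating3 s" and t: "alternating3 t"
  shows "alternating3 (\<lambda>g h k. s g h k - t g h k)"
  unfolding alternating3_def
proof (intro conjI ballI)
  fix h k assume hk: "h \<in> carrier G" "k \<in> carrier G"
  have "character (\<lambda>g. s g h k + (-1) * t g h k)"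
    using s t hk by (intro character_add character_scale) (auto simp: alternating3_def)
  then show "character (\<lambda>g. s g h k - t g h k)" by simp
  have st: "[s g h k = 0] (mod int p)" "[t g h k = 0] (mod int p)" if "g \<in> Z" for g
    using s t hk that by (auto simp: alternating3_def kills_center_def)
  show "kills_center (\<lambda>g. s g h k - t g h k)"
    unfolding kills_center_def
  proof
    fix g assume "g \<in> Z"
    from cong_diff[OF st[OF this]] show "[s g h k - t g h k = 0] (mod int p)" by simp
  qed
next
  fix g h k assume ghk: "g \<in> carrier G" "h \<in> carrier G" "k \<in> carrier G"
  have a: "[s g h k = s h k g] (mod int p)" "[t g h k = t h k g] (mod int p)"
    "[s g h k = - s h g k] (mod int p)" "[t g h k = - t h g k] (mod int p)"
    "[s g g k = 0] (mod int p)" "[t g g k = 0] (mod int p)"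
    using s t ghk by (auto simp: alternating3_def)
  show "[s g h k - t g h k = s h k g - t h k g] (mod int p)" by (rule cong_diff[OF a(1,2)])
  show "[s g h k - t g h k = - (s h g k - t h g k)] (mod int p)" using cong_diff[OF a(3,4)] by simp
  show "[s g g k - t g g k = 0] (mod int p)" using cong_diff[OF a(5,6)] by simp
qed

end

section \<open>Wedge products in dimension at most four\<close>

text \<open>The elements \<open>x i\<close> represent a basis of the quotient by the center, and the
  \<open>e i\<close> are the dual basis of linear forms.\<close>

locale class_two_basis = class_two_group G p for G (structure) and p +
  fixes n :: nat and x :: "nat \<Rightarrow> 'a" and e :: "nat \<Rightarrow> 'a \<Rightarrow> int"
  assumes x_carrier: "i < n \<Longrightarrow> x i \<in> carrier G"
    and gen: "generate G (Z \<union> x ` {..<n}) = carrier G"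
    and e_character: "i < n \<Longrightarrow> character (e i)"
    and e_center: "i < n \<Longrightarrow> kills_center (e i)"
    and dual: "i < n \<Longrightarrow> j < n \<Longrightarrow> [e i (x j) = of_bool (i = j)] (mod int p)"

context class_two_group
begin

text \<open>Let \<open>B\<close> be a smallest part of a generating set that generates
  \<open>G\<close> together with the center. By minimality no \<open>x i\<close> lies in the
  subgroup generated by the center and the remaining ones, so a character separates it from them. If
  \<open>n = k\<close>, nothing was discarded, so \<open>B\<close> generates \<open>G\<close>
  without the help of the center.\<close>

lemma basis_exists:
  assumes "generated_by_at_most G k"
  shows "\<exists>n x e. class_two_basis G p n x e \<and> n \<le> k \<and>
    (n = k \<longrightarrow> generate G (x ` {..<n}) = carrier G)"
proof -
  obtain S where S: "S \<subseteq> carrier G" "finite S" "card S \<le> k" "generate G S = carrier G"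
    using assms by (auto simp: generated_by_at_most_def)
  have Zc: "Z \<subseteq> carrier G" using Z_carrier by blast
  let ?P = "\<lambda>B. B \<subseteq> S \<and> generate G (Z \<union> B) = carrier G"
  have "generate G (Z \<union> S) = carrier G"
    using mono_generate[of S "Z \<union> S"] generate_incl[of "Z \<union> S"] S Zc by auto
  then have "?P S" by simp
  then obtain B where B: "?P B" and least: "\<And>C. ?P C \<Longrightarrow> card B \<le> card C"
    using ex_has_least_nat[of ?P S card] by blast
  have finB: "finite B" using B S finite_subset by blast
  let ?n = "card B"
  obtain x where x: "bij_betw x {..<?n} B"
    using ex_bij_betw_nat_finite[OF finB] by (auto simp: atLeast0LessThan)
  then have xB: "x ` {..<?n} = B" and inj: "inj_on x {..<?n}" by (auto simp: bij_betw_def)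
  have Bc: "B \<subseteq> carrier G" using B S by blast
  have xc: "x i \<in> carrier G" if "i < ?n" for i using that xB Bc by auto
  have "\<exists>f. character f \<and> kills_center f \<and> (\<forall>j<?n. [f (x j) = of_bool (i = j)] (mod int p))" if i: "i < ?n" for i
  proof -
    let ?H = "generate G (Z \<union> (B - {x i}))"
    have sub: "Z \<union> (B - {x i}) \<subseteq> carrier G" using Zc Bc by blast
    have H: "subgroup ?H G" by (rule generate_is_subgroup[OF sub])
    have ZH: "Z \<subseteq> ?H" and BH: "B - {x i} \<subseteq> ?H" by (auto intro: generate.incl)
    have "x i \<notin> ?H"
    proof
      assume "x i \<in> ?H"
      then have "Z \<union> B \<subseteq> ?H" using ZH BH by blast
      then have "carrier G \<subseteq> ?H" using generate_subgroup_incl[OF _ H, of "Z \<union> B"] B by blast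
      then have "?P (B - {x i})" using B generate_incl[OF sub] by blast
      then have "card B \<le> card (B - {x i})" by (rule least)
      moreover have "x i \<in> B" using xB i by blast
      ultimately show False using card_Diff1_less[OF finB] by (metis leD)
    qed
    then obtain f where f: "character f" "\<And>h. h \<in> ?H \<Longrightarrow> [f h = 0] (mod int p)" "[f (x i) = 1] (mod int p)"
      using separating_character[OF H _ xc[OF i]] ZH derived_subset_center by (metis order_trans)
    have "[f (x j) = of_bool (i = j)] (mod int p)" if j: "j < ?n" for j
    proof (cases "i = j")
      case False
      then have "x j \<in> B - {x i}" using xB inj i j by (auto simp: inj_on_eq_iff)
      then show ?thesis using f(2) BH False by auto
    qed (use f in simp)
    moreover have "kills_center f" using f(2) ZH by (auto simp: kills_center_def)
    ultimately show ?thesis using f(1) by blast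
  qed
  then obtain e where e: "\<And>i. i < ?n \<Longrightarrow> character (e i) \<and> kills_center (e i) \<and>
      (\<forall>j<?n. [e i (x j) = of_bool (i = j)] (mod int p))" by metis
  have "generate G (x ` {..<?n}) = carrier G" if "?n = k"
  proof -
    have "card S \<le> card B" using S that by simp
    then have "B = S" using B S(2) card_seteq by blast
    then show ?thesis using xB S by simp
  qed
  moreover have "?n \<le> k" using card_mono[OF S(2), of B] B S(3) by simp
  moreover have "generate G (Z \<union> x ` {..<?n}) = carrier G" using B xB by simp
  ultimately have "class_two_basis G p ?n x e" "?n \<le> k" "?n = k \<longrightarrow> generate G (x ` {..<?n}) = carrier G"
    using e xc by (auto intro!: class_two_basis.intro class_two_group_axioms class_two_basis_axioms.intro)
  then show ?thesis by blast
qed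

end

section \<open>Coordinates and the wedge map\<close>

context class_two_basis
begin

lemma zero_on_basis:
  assumes "character f" "kills_center f" "\<And>i. i < n \<Longrightarrow> [f (x i) = 0] (mod int p)" "g \<in> carrier G"
  shows "[f g = 0] (mod int p)"
  by (rule character_eq_zeroI[OF assms(1) gen _ _ assms(4)])
    (use assms x_carrier Z_carrier in \<open>auto simp: kills_center_def\<close>)

lemma alternating3_zero:
  assumes t: "alternating3 t"
    and sorted: "\<And>i j l. i < j \<Longrightarrow> j < l \<Longrightarrow> l < n \<Longrightarrow> [t (x i) (x j) (x l) = 0] (mod int p)"
    and ghk: "g \<in> carrier G" "h \<in> carrier G" "k \<in> carrier G"
  shows "[t g h k = 0] (mod int p)"
proof -
  have cyc: "[t g h k = 0] (mod int p) \<longleftrightarrow> [t h k g = 0] (mod int p)"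
    if "g \<in> carrier G" "h \<in> carrier G" "k \<in> carrier G" for g h k
    using t that unfolding alternating3_def by (meson cong_sym cong_trans)
  have swap: "[t g h k = 0] (mod int p) \<longleftrightarrow> [t h g k = 0] (mod int p)"
    if "g \<in> carrier G" "h \<in> carrier G" "k \<in> carrier G" for g h k
  proof -
    have "[t g h k = - t h g k] (mod int p)" using t that by (auto simp: alternating3_def)
    then show ?thesis by (metis cong_0_iff cong_dvd_iff dvd_minus_iff)
  qed
  have same: "[t g g k = 0] (mod int p)" if "g \<in> carrier G" "k \<in> carrier G" for g k
    using t that by (auto simp: alternating3_def)
  \<comment> \<open>Extends vanishing from the basis to the whole group in the first argument;
    applied three times, with cyclic shifts in between.\<close>
  have ext: "[t g h k = 0] (mod int p)"
    if "\<And>i. i < n \<Longrightarrow> [t (x i) h k = 0] (mod int p)" "g \<in> carrier G" "h \<in> carrier G" "k \<in> carrier G" for g h k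
    using zero_on_basis[of "\<lambda>g. t g h k"] t that by (auto simp: alternating3_def)
  have basis: "[t (x i) (x j) (x l) = 0] (mod int p)" if ijl: "i < n" "j < n" "l < n" for i j l
  proof -
    note c = cyc[OF x_carrier x_carrier x_carrier] and s = swap[OF x_carrier x_carrier x_carrier]
      and d = same[OF x_carrier x_carrier]
    consider "i = j" | "j = l" | "i = l" | "i < j" "j < l" | "i < l" "l < j" | "j < i" "i < l"
      | "j < l" "l < i" | "l < i" "i < j" | "l < j" "j < i" by linarith
    then show ?thesis
    proof cases
      case 1 then show ?thesis using d ijl by simp
    next
      case 2 then show ?thesis using d[of j i] c[of i j j] ijl by simp
    next
      case 3 then show ?thesis using d[of i j] c[of i i j] c[of i j i] ijl by simp
    next
      case 4 then show ?thesis using sorted ijl by simp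
    next
      case 5 then show ?thesis using sorted[of i l j] c[of i j l] s[of j l i] c[of l i j] c[of i l j] s[of i l j] c[of l j i] ijl by simp
    next
      case 6 then show ?thesis using sorted[of j i l] s[of i j l] ijl by simp
    next
      case 7 then show ?thesis using sorted[of j l i] c[of i j l] ijl by simp
    next
      case 8 then show ?thesis using sorted[of l i j] c[of l i j] ijl by simp
    next
      case 9 then show ?thesis using sorted[of l j i] s[of i j l] c[of j i l] c[of l j i] ijl by simp
    qed
  qed
  have 1: "[t g (x j) (x l) = 0] (mod int p)" if "j < n" "l < n" "g \<in> carrier G" for j l g
    using ext[of "x j" "x l" g] basis that x_carrier by blast
  have 2: "[t h (x l) g = 0] (mod int p)" if "l < n" "g \<in> carrier G" "h \<in> carrier G" for l g h
    using ext[of "x l" g h] 1 cyc x_carrier that by blast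
  show ?thesis
    using ext[of h k g] 2 cyc x_carrier ghk by blast
qed

definition comb :: "(nat \<Rightarrow> int) \<Rightarrow> 'a \<Rightarrow> int" where
  "comb c g = (\<Sum>i<n. c i * e i g)"

lemma comb_character: "character (comb c)"
  unfolding comb_def using e_character by (intro character_sum character_scale) simp

lemma comb_center: "kills_center (comb c)"
  unfolding kills_center_def comb_def
proof
  fix z assume "z \<in> Z"
  then have "[(\<Sum>i<n. c i * e i z) = (\<Sum>i<n. c i * 0)] (mod int p)"
    using e_center by (intro cong_sum cong_mult cong_refl) (auto simp: kills_center_def)
  then show "[(\<Sum>i<n. c i * e i z) = 0] (mod int p)" by simp
qed

lemma comb_basis:
  assumes "j < n" shows "[comb c (x j) = c j] (mod int p)"
proof -
  have "[(\<Sum>i<n. c i * e i (x j)) = (\<Sum>i<n. c i * of_bool (i = j))] (mod int p)"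
    using dual assms by (intro cong_sum cong_mult cong_refl) auto
  also have "(\<Sum>i<n. c i * of_bool (i = j)) = c j" using assms by (simp add: of_bool_def if_distrib sum.delta cong: if_cong)
  finally show ?thesis by (simp add: comb_def)
qed

text \<open>Counting replaces linear algebra: there are \<open>p ^ n\<close> linear forms
  \<open>l\<close>, and \<open>l\<close> \<and> \<omega> is determined by its residues at
  \<open>card T\<close> triples. Two forms \<open>l\<close> with the same image differ by a nonzero
  one with \<open>l\<close> \<and> \<omega> = 0. If the map is injective,
  \<open>n \<le> card T\<close> forces \<open>n = 4\<close>; then both sides have equal size and the
  map is onto.\<close>

lemma wedge_dichotomy:
  assumes f: "functional f" and n: "2 \<le> n" "n \<le> 4"
  shows "(\<exists>l. character l \<and> kills_center l \<and> (\<exists>g\<in>carrier G. \<not> [l g = 0] (mod int p)) \<and>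
      (\<forall>g\<in>carrier G. \<forall>h\<in>carrier G. \<forall>k\<in>carrier G. [wedge l (form f) g h k = 0] (mod int p)))
    \<or> (n = 4 \<and> (\<forall>s. alternating3 s \<longrightarrow> (\<exists>l. character l \<and> kills_center l \<and>
      (\<forall>g\<in>carrier G. \<forall>h\<in>carrier G. \<forall>k\<in>carrier G. [wedge l (form f) g h k = s g h k] (mod int p)))))"
proof -
  define T where "T = {(i, j, l). i < j \<and> j < l \<and> l < n}"
  note cardT = card_increasing_triples[OF n, folded T_def]
  have p1: "1 < int p" using prime_p prime_gt_1_nat by simp
  let ?V = "{..<n} \<rightarrow>\<^sub>E {0..<int p}" and ?W = "T \<rightarrow>\<^sub>E {0..<int p}"
  \<comment> \<open>Trilinear forms are coded by residues at increasing triples of basis elements;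
    by \<open>alternating3_zero\<close> this loses nothing for alternating ones.\<close>
  define val where "val t = (\<lambda>(i, j, l). t (x i) (x j) (x l) mod int p)" for t :: "'a \<Rightarrow> 'a \<Rightarrow> 'a \<Rightarrow> int"
  define \<Phi> where "\<Phi> c = restrict (val (wedge (comb c) (form f))) T" for c
  have finW: "finite ?W" using cardT(1) by (intro finite_PiE) auto
  have cardV: "card ?V = p ^ n" and cardW: "card ?W = p ^ card T"
    by (simp_all add: card_PiE cardT(1))
  have val: "val t u \<in> {0..<int p}" for t u using p1 by (cases u) (simp add: val_def)
  then have \<Phi>W: "\<Phi> ` ?V \<subseteq> ?W" unfolding \<Phi>_def by (intro image_subsetI) (simp only: restrict_PiE_iff, blast)
  have alt: "alternating3 (wedge (comb c) (form f))" for c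
    using comb_character comb_center f by (rule alternating3_wedge)
  show ?thesis
  proof (cases "inj_on \<Phi> ?V")
    case False
    then obtain c d where cd: "c \<in> ?V" "d \<in> ?V" "c \<noteq> d" "\<Phi> c = \<Phi> d" by (auto simp: inj_on_def)
    then obtain i where i: "i < n" "c i \<noteq> d i" by (metis PiE_ext lessThan_iff)
    let ?l = "comb (\<lambda>i. c i - d i)"
    have l: "?l g = comb c g - comb d g" for g by (simp add: comb_def left_diff_distrib sum_subtractf)
    have nz: "\<not> [?l (x i) = 0] (mod int p)"
    proof
      assume "[?l (x i) = 0] (mod int p)"
      then have "[c i - d i = 0] (mod int p)" using comb_basis[OF i(1)] by (meson cong_sym cong_trans)
      then have "[c i = d i] (mod int p)" by (simp add: cong_diff_iff_cong_0)
      moreover have "c i \<in> {0..<int p}" "d i \<in> {0..<int p}" using cd i by (auto simp: PiE_iff)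
      ultimately show False using i by (simp add: cong_def)
    qed
    have wz: "[wedge ?l (form f) g h k = 0] (mod int p)"
      if ghk: "g \<in> carrier G" "h \<in> carrier G" "k \<in> carrier G" for g h k
    proof (rule alternating3_zero[OF alt _ ghk])
      fix i j l assume ijl: "i < j" "j < l" "l < n"
      then have "(i, j, l) \<in> T" by (simp add: T_def)
      then have "val (wedge (comb c) (form f)) (i, j, l) = val (wedge (comb d) (form f)) (i, j, l)"
        using cd(4) unfolding \<Phi>_def by (metis restrict_apply')
      then have "[wedge (comb c) (form f) (x i) (x j) (x l) = wedge (comb d) (form f) (x i) (x j) (x l)] (mod int p)"
        by (simp add: val_def cong_def)
      then show "[wedge ?l (form f) (x i) (x j) (x l) = 0] (mod int p)"
        by (rule cong_comb1[where u = 1]) (simp add: wedge_def l algebra_simps)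
    qed
    show ?thesis
      by (intro disjI1 exI[of _ ?l] conjI comb_character comb_center ballI
          bexI[of _ "x i"] nz wz x_carrier[OF i(1)])
  next
    case True
    then have "p ^ n \<le> p ^ card T" using card_inj_on_le[OF True \<Phi>W finW] cardV cardW by simp
    then have "n \<le> card T" using p1 power_le_imp_le_exp[of p n "card T"] by simp
    then have n4: "n = 4" using cardT(3) by force
    then have "card (\<Phi> ` ?V) = card ?W" using card_image[OF True] cardV cardW cardT(4) by simp
    then have surj: "\<Phi> ` ?V = ?W" using card_subset_eq[OF finW \<Phi>W] by simp
    have "\<exists>l. character l \<and> kills_center l \<and>
      (\<forall>g\<in>carrier G. \<forall>h\<in>carrier G. \<forall>k\<in>carrier G. [wedge l (form f) g h k = s g h k] (mod int p))"
      if s: "alternating3 s" for s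
    proof -
      have "restrict (val s) T \<in> ?W" using val by (simp only: restrict_PiE_iff, blast)
      then obtain c where c: "\<Phi> c = restrict (val s) T" using surj by (metis imageE)
      have "[wedge (comb c) (form f) g h k = s g h k] (mod int p)"
        if ghk: "g \<in> carrier G" "h \<in> carrier G" "k \<in> carrier G" for g h k
      proof -
        have "[wedge (comb c) (form f) g h k - s g h k = 0] (mod int p)"
        proof (rule alternating3_zero[OF alternating3_diff[OF alt s] _ ghk])
          fix i j l assume ijl: "i < j" "j < l" "l < n"
          then have "(i, j, l) \<in> T" by (simp add: T_def)
          then have "val (wedge (comb c) (form f)) (i, j, l) = val s (i, j, l)"
            using c unfolding \<Phi>_def by (metis restrict_apply')
          then show "[wedge (comb c) (form f) (x i) (x j) (x l) - s (x i) (x j) (x l) = 0] (mod int p)"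
            by (simp add: val_def cong_def[symmetric] cong_diff_iff_cong_0)
        qed
        then show ?thesis by (simp add: cong_diff_iff_cong_0)
      qed
      then show ?thesis
        by (intro exI[of _ "comb c"] conjI comb_character comb_center ballI)
    qed
    then show ?thesis using n4 by simp
  qed
qed

end

section \<open>The extraspecial case and the classification\<close>

context class_two_basis
begin

text \<open>If the \<open>x i\<close> generate \<open>G\<close>, every character agrees with a
  combination of the \<open>e i\<close> and so kills the center, whereas a central element outside
  the derived subgroup would be detected by some character.\<close>

lemma center_eq_derived:
  assumes gen': "generate G (x ` {..<n}) = carrier G"
  shows "Z = derived_sub"
proof
  show "Z \<subseteq> derived_sub"
  proof
    fix a assume a: "a \<in> Z"
    show "a \<in> derived_sub"
    proof (rule ccontr)
      assume "a \<notin> derived_sub"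
      then obtain l where l: "character l" "[l a = 1] (mod int p)"
        using separating_character[OF derived_is_subgroup[OF subset_refl] subset_refl Z_carrier[OF a]] by metis
      let ?c = "\<lambda>i. l (x i)"
      have "character (\<lambda>g. l g + (-1) * comb ?c g)" using l comb_character by (intro character_add character_scale)
      moreover have "[l (x i) + (-1) * comb ?c (x i) = 0] (mod int p)" if "i < n" for i
        by (rule cong_comb1[OF comb_basis[OF that, of ?c], where u = "-1"]) simp
      ultimately have "[l a + (-1) * comb ?c a = 0] (mod int p)"
        using character_eq_zeroI[OF _ gen' _ _ Z_carrier[OF a], of "\<lambda>g. l g + (-1) * comb ?c g"] x_carrier by auto
      moreover have "[comb ?c a = 0] (mod int p)" using comb_center a by (simp add: kills_center_def)
      ultimately have "[l a = 0] (mod int p)" by (rule cong_comb2[where u = 1 and v = 1]) simp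
      then have "[1 = 0] (mod int p)" using l(2) by (meson cong_sym cong_trans)
      then show False using prime_p prime_gt_1_nat[of p] by (simp add: cong_def)
    qed
  qed
qed (rule derived_subset_center)

text \<open>The \<open>e i\<close> span the linear forms on the quotient by the center, and these
  separate its points.\<close>

lemma in_center_if_e_zero:
  assumes "g \<in> carrier G" "\<And>i. i < n \<Longrightarrow> [e i g = 0] (mod int p)"
  shows "g \<in> Z"
proof (rule ccontr)
  assume "g \<notin> Z"
  then obtain l where l: "character l" "kills_center l" "[l g = 1] (mod int p)"
    using separating_character[OF center_subgroup derived_subset_center assms(1)] kills_center_def by metis
  let ?c = "\<lambda>i. l (x i)"
  have "character (\<lambda>g. l g + (-1) * comb ?c g)" using l comb_character by (intro character_add character_scale)
  moreover have "kills_center (\<lambda>g. l g + (-1) * comb ?c g)"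
    unfolding kills_center_def
  proof
    fix c assume "c \<in> Z"
    then have "[l c = 0] (mod int p)" "[comb ?c c = 0] (mod int p)"
      using l comb_center by (auto simp: kills_center_def)
    then show "[l c + (-1) * comb ?c c = 0] (mod int p)" by (rule cong_comb2[where u = 1 and v = "-1"]) simp
  qed
  moreover have "[l (x i) + (-1) * comb ?c (x i) = 0] (mod int p)" if "i < n" for i
    by (rule cong_comb1[OF comb_basis[OF that, of ?c], where u = "-1"]) simp
  ultimately have "[l g + (-1) * comb ?c g = 0] (mod int p)" using assms(1) by (rule zero_on_basis)
  moreover have "[comb ?c g = (\<Sum>i<n. ?c i * 0)] (mod int p)"
    unfolding comb_def using assms(2) by (intro cong_sum cong_mult cong_refl) auto
  ultimately have "[l g = 0] (mod int p)" by (rule cong_comb2[where u = 1 and v = 1]) simp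
  then have "[1 = 0] (mod int p)" using l(3) by (meson cong_sym cong_trans)
  then show False using prime_p prime_gt_1_nat[of p] by (simp add: cong_def)
qed

text \<open>The coordinates are adjusted one at a time; \<open>m\<close> is there for the induction,
  and the lemma is used with \<open>m = n\<close>.\<close>

lemma e_surj:
  assumes "m \<le> n"
  shows "\<exists>g\<in>carrier G. \<forall>i<n. [e i g = (if i < m then c i else 0)] (mod int p)"
  using assms
proof (induct m)
  case 0
  then show ?case using character_one e_character by (intro bexI[of _ \<one>]) auto
next
  case (Suc m)
  then obtain g where g: "g \<in> carrier G" "\<And>i. i < n \<Longrightarrow> [e i g = (if i < m then c i else 0)] (mod int p)" by auto
  obtain w where w: "w \<in> carrier G" "\<And>f. character f \<Longrightarrow> [f w = 1 * f g + c m * f (x m)] (mod int p)"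
    using character_combination[OF g(1) x_carrier[of m], of 1 "c m"] Suc(2) by auto
  show ?case
  proof (intro bexI[OF _ w(1)] allI impI)
    fix i assume i: "i < n"
    have "[e i w = 1 * e i g + c m * e i (x m)] (mod int p)" using w(2) e_character[OF i] by blast
    also have "[1 * e i g + c m * e i (x m) = 1 * (if i < m then c i else 0) + c m * of_bool (i = m)] (mod int p)"
      using g(2)[OF i] dual[OF i, of m] Suc(2) by (intro cong_add cong_mult cong_refl) simp_all
    also have "1 * (if i < m then c i else 0) + c m * of_bool (i = m) = (if i < Suc m then c i else 0)"
      by (auto simp: less_Suc_eq)
    finally show "[e i w = (if i < Suc m then c i else 0)] (mod int p)" .
  qed
qed

text \<open>The \<open>e i\<close> together with a functional \<open>f\<close> normalized by
  \<open>f z = 1\<close> are coordinates: they identify \<open>G\<close> with the tuples of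
  \<open>n + 1\<close> residues modulo \<open>p\<close>.\<close>

lemma order_if_center_cyclic:
  assumes z: "z \<in> Z" "z \<noteq> \<one>" and cyc: "\<And>c. c \<in> Z \<Longrightarrow> \<exists>k::int. c = z [^] k"
  shows "card Z = p" "order G = p ^ Suc n"
proof -
  have p1: "1 < int p" using prime_p prime_gt_1_nat by simp
  have "z \<notin> {\<one>}" using z by simp
  then obtain f where f: "functional f" "[f z = 1] (mod int p)"
    using separating_functional[OF triv_subgroup Z_carrier[OF z(1)]] by metis
  have fz: "[f (z [^] (k::nat)) = int k] (mod int p)" for k
  proof -
    have "[int k * f z = int k * 1] (mod int p)" using f by (intro cong_mult cong_refl)
    then show ?thesis using functional_pow[OF f(1) Z_carrier[OF z(1)], of k] by (simp add: cong_trans)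
  qed
  have zk: "\<exists>k<p. c = z [^] k" if "c \<in> Z" for c
  proof -
    obtain k :: int where k: "c = z [^] k" using cyc \<open>c \<in> Z\<close> by blast
    have "[int (nat (k mod int p)) = k] (mod int p)" using p1 by (simp add: cong_def)
    then have "z [^] int (nat (k mod int p)) = z [^] k"
      using z exponent by (intro int_pow_cong) auto
    moreover have "nat (k mod int p) < p" using p1 by (simp add: nat_less_iff)
    ultimately show ?thesis using k by (intro exI[of _ "nat (k mod int p)"]) (simp add: int_pow_int)
  qed
  have inj: "inj_on (\<lambda>k::nat. z [^] k) {..<p}"
  proof (rule inj_onI)
    fix k m assume km: "k \<in> {..<p}" "m \<in> {..<p}" "z [^] k = z [^] m"
    then have "[int k = int m] (mod int p)" using fz[of k] fz[of m] by (metis cong_sym cong_trans)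
    then show "k = m" using km by (simp add: cong_int_iff cong_def)
  qed
  have "Z = (\<lambda>k::nat. z [^] k) ` {..<p}" using zk center_nat_pow z by auto
  then show "card Z = p" using card_image[OF inj] by simp
  let ?C = "({..<n} \<rightarrow>\<^sub>E {0..<int p}) \<times> {0..<int p}"
  define \<Psi> where "\<Psi> g = (restrict (\<lambda>i. e i g mod int p) {..<n}, f g mod int p)" for g
  have "bij_betw \<Psi> (carrier G) ?C"
    unfolding bij_betw_def
  proof
    show "inj_on \<Psi> (carrier G)"
    proof (rule inj_onI)
      fix g h assume g: "g \<in> carrier G" and h: "h \<in> carrier G" and eq: "\<Psi> g = \<Psi> h"
      have "[e i g = e i h] (mod int p)" if "i < n" for i
      proof -
        have "restrict (\<lambda>i. e i g mod int p) {..<n} i = restrict (\<lambda>i. e i h mod int p) {..<n} i"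
          using eq by (simp add: \<Psi>_def)
        then show ?thesis using that by (simp add: cong_def)
      qed
      note eqe = this
      let ?u = "inv h \<otimes> g"
      have gu: "g = h \<otimes> ?u" using g h by (simp add: m_assoc[symmetric])
      have u: "?u \<in> Z"
      proof (rule in_center_if_e_zero)
        fix i assume i: "i < n"
        have "[e i g = e i h + e i ?u] (mod int p)"
          using character_mult[OF e_character[OF i], of h ?u] g h gu by simp
        then show "[e i ?u = 0] (mod int p)"
          by (rule cong_comb2[OF _ eqe[OF i], where u = "-1" and v = 1]) simp
      qed (use g h in simp)
      have "[f g = f h + f ?u] (mod int p)" using functional_mult_center(1)[OF f(1) h u] gu by simp
      moreover have "[f g = f h] (mod int p)" using eq by (simp add: \<Psi>_def cong_def)
      ultimately have fu: "[f ?u = 0] (mod int p)" by (rule cong_comb2[where u = "-1" and v = 1]) simp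
      obtain k where k: "k < p" "?u = z [^] k" using zk[OF u] by blast
      have "[int k = 0] (mod int p)" using fz[of k] fu k by (metis cong_sym cong_trans)
      then have "k = 0" using k(1) by (simp add: cong_def)
      then show "g = h" using gu k(2) h by simp
    qed
    show "\<Psi> ` carrier G = ?C"
    proof
      show "\<Psi> ` carrier G \<subseteq> ?C"
        unfolding \<Psi>_def using p1 by (intro image_subsetI SigmaI) (simp_all add: restrict_PiE_iff)
      show "?C \<subseteq> \<Psi> ` carrier G"
      proof
        fix cj assume "cj \<in> ?C"
        then obtain c j where cj: "cj = (c, j)" "c \<in> {..<n} \<rightarrow>\<^sub>E {0..<int p}" "j \<in> {0..<int p}" by blast
        obtain g where g: "g \<in> carrier G" "\<And>i. i < n \<Longrightarrow> [e i g = c i] (mod int p)"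
          using e_surj[of n c] by auto
        \<comment> \<open>Multiplying by a power of the central element \<open>z\<close> corrects
          the last coordinate and leaves the others unchanged.\<close>
        let ?k = "nat ((j - f g) mod int p)"
        let ?w = "g \<otimes> z [^] ?k"
        have zc: "z [^] ?k \<in> Z" using z by (simp add: center_nat_pow)
        have "[int ?k = j - f g] (mod int p)" using p1 by (simp add: cong_def)
        then have "[f (z [^] ?k) = j - f g] (mod int p)" using fz cong_trans by blast
        then have "[f ?w = j] (mod int p)"
          by (rule cong_comb2[OF functional_mult_center(1)[OF f(1) g(1) zc], where u = 1 and v = 1]) simp
        then have fw: "f ?w mod int p = j" using cj(3) by (simp add: cong_def)
        have ew: "e i ?w mod int p = c i" if i: "i < n" for i
        proof -
          have "[e i (z [^] ?k) = 0] (mod int p)" using e_center[OF i] zc by (simp add: kills_center_def)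
          moreover have "[e i ?w = e i g + e i (z [^] ?k)] (mod int p)"
            using character_mult[OF e_character[OF i] g(1) Z_carrier[OF zc]] .
          ultimately have "[e i ?w = e i g] (mod int p)" by (rule cong_comb2[where u = 1 and v = 1]) simp
          then have "[e i ?w = c i] (mod int p)" using g(2)[OF i] by (rule cong_trans)
          moreover have "c i \<in> {0..<int p}" using PiE_mem[OF cj(2), of i] i by simp
          ultimately show ?thesis by (simp add: cong_def)
        qed
        have "restrict (\<lambda>i. e i ?w mod int p) {..<n} = c"
          using cj(2) ew by (intro ext) (auto simp: restrict_def PiE_iff extensional_def)
        then have "\<Psi> ?w = cj" using fw cj(1) by (simp add: \<Psi>_def)
        moreover have "?w \<in> carrier G" using g(1) zc by simp
        ultimately show "cj \<in> \<Psi> ` carrier G" by blast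
      qed
    qed
  qed
  then have "card (carrier G) = card ?C" by (rule bij_betw_same_card)
  also have "\<dots> = p ^ Suc n" by (simp add: card_cartesian_product card_PiE)
  finally show "order G = p ^ Suc n" by (simp add: order_def)
qed

end

section \<open>Cocycles detecting a given central element\<close>

context class_two_group
begin

text \<open>The central quotient is abelian because the center is the derived subgroup. If it were
  trivial, \<open>G\<close> would be abelian and the derived subgroup trivial, contrary to its order
  \<open>p\<close>.\<close>

lemma extraspecialI:
  assumes Z: "Z = derived_sub" and card: "card Z = p" "order G = p ^ k"
  shows "extraspecial p G"
proof -
  interpret N: normal Z G using center_normal[OF is_group] .
  have "comm_group (G Mod Z)" using derived_quot_is_comm_group Z by simp
  moreover have "of_exponent (G Mod Z) p"
    unfolding of_exponent_def
  proof
    fix u assume "u \<in> carrier (G Mod Z)"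
    then obtain g where g: "g \<in> carrier G" "u = Z #> g" by (auto simp: carrier_FactGroup)
    then have "u [^]\<^bsub>G Mod Z\<^esub> p = Z #> \<one>" using N.FactGroup_pow exponent by simp
    also have "\<dots> = Z" using N.subset by (rule coset_mult_one)
    finally show "u [^]\<^bsub>G Mod Z\<^esub> p = \<one>\<^bsub>G Mod Z\<^esub>" by simp
  qed
  moreover have "\<not> trivial_group (G Mod Z)"
  proof
    assume triv: "trivial_group (G Mod Z)"
    have inZ: "g \<in> Z" if g: "g \<in> carrier G" for g
    proof -
      have "Z #> g \<in> carrier (G Mod Z)" using g by (auto simp: carrier_FactGroup)
      then have "Z #> g = Z" using triv by (simp add: trivial_group_def)
      then show ?thesis using coset_join1[OF _ g N.subgroup_axioms] N.subset by blast
    qed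
    have "comm g h = \<one>" if "g \<in> carrier G" "h \<in> carrier G" for g h
      using inZ[OF that(1)] that(2) by (rule comm_center(1))
    then have "{comm g h | g h. g \<in> carrier G \<and> h \<in> carrier G} \<subseteq> {\<one>}" by auto
    then have "derived_sub \<subseteq> {\<one>}"
      unfolding derived_sub_eq using generate_subgroup_incl[OF _ triv_subgroup] by blast
    then have "card Z \<le> 1" using Z card_mono[of "{\<one>}" derived_sub] by simp
    then show False using card prime_p prime_gt_1_nat[of p] by simp
  qed
  ultimately show ?thesis using card is_group by (auto simp: extraspecial_def)
qed

text \<open>The cocycle is the product of a character \<open>l\<close> with \<open>l z = 1\<close>
  and a nonzero character \<open>m\<close> vanishing on a proper subgroup \<open>H\<close> that
  contains \<open>z\<close> and the derived subgroup. For \<open>H\<close> one takes the center or,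
  if \<open>G\<close> is abelian, the subgroup generated by \<open>z\<close>, which is proper as
  \<open>G\<close> is not cyclic.\<close>

lemma cocycle_outside_derived:
  assumes z: "z \<in> Z" "z \<notin> derived_sub" and nc: "\<not> cyclic_group G"
  shows "\<exists>f. normalized_cocycle G (int p) f \<and> (\<exists>h\<in>carrier G. \<not> [f z h = f h z] (mod int p))"
proof -
  have p1: "1 < int p" using prime_p prime_gt_1_nat by simp
  obtain l where l: "character l" "[l z = 1] (mod int p)"
    using separating_character[OF derived_is_subgroup[OF subset_refl] subset_refl Z_carrier[OF z(1)] z(2)] by metis
  obtain H where H: "subgroup H G" "derived_sub \<subseteq> H" "z \<in> H" "H \<noteq> carrier G"
  proof (cases "Z = carrier G")
    case False
    then show thesis using that[of Z] center_subgroup derived_subset_center z by blast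
  next
    case True
    have "comm g h = \<one>" if "g \<in> carrier G" "h \<in> carrier G" for g h
      using that comm_center(1)[of g h] unfolding True by blast
    then have "{comm g h | g h. g \<in> carrier G \<and> h \<in> carrier G} \<subseteq> {\<one>}" by auto
    then have D: "derived_sub \<subseteq> {\<one>}"
      unfolding derived_sub_eq using generate_subgroup_incl[OF _ triv_subgroup] by blast
    let ?H = "generate G {z}"
    have zc: "z \<in> carrier G" using z by simp
    have "?H \<noteq> carrier G"
    proof
      assume "?H = carrier G"
      then have "carrier G = range (\<lambda>n::int. z [^] n)" using generate_pow[OF zc] by (simp add: full_SetCompr_eq)
      then show False using nc cyclic_group zc by blast
    qed
    moreover have "subgroup ?H G" using zc by (intro generate_is_subgroup) simp
    moreover have "derived_sub \<subseteq> ?H" using D generate.one by blast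
    moreover have "z \<in> ?H" by (intro generate.incl) simp
    ultimately show thesis using that by blast
  qed
  obtain h where h: "h \<in> carrier G" "h \<notin> H" using H subgroup.subset by blast
  obtain m where m: "character m" "\<And>u. u \<in> H \<Longrightarrow> [m u = 0] (mod int p)" "[m h = 1] (mod int p)"
    using separating_character[OF H(1,2) h] by metis
  define f where "f g k = l g * m k" for g k
  have "normalized_cocycle G (int p) f"
    unfolding normalized_cocycle_def
  proof (intro conjI ballI)
    fix g assume "g \<in> carrier G"
    have "[f g \<one> = l g * 0] (mod int p)" unfolding f_def using character_one[OF m(1)] by (intro cong_mult cong_refl)
    then show "[f g \<one> = 0] (mod int p)" by simp
    have "[f \<one> g = 0 * m g] (mod int p)" unfolding f_def using character_one[OF l(1)] by (intro cong_mult cong_refl)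
    then show "[f \<one> g = 0] (mod int p)" by simp
  next
    fix g h k assume ghk: "g \<in> carrier G" "h \<in> carrier G" "k \<in> carrier G"
    show "[f g h + f (g \<otimes> h) k = f h k + f g (h \<otimes> k)] (mod int p)"
      by (rule cong_comb2[OF character_mult[OF l(1) ghk(1,2)] character_mult[OF m(1) ghk(2,3)],
            where u = "m k" and v = "- l g"]) (simp add: f_def algebra_simps)
  qed
  moreover have "\<not> [f z h = f h z] (mod int p)"
  proof
    assume e: "[f z h = f h z] (mod int p)"
    have "[f z h = 1 * 1] (mod int p)" unfolding f_def using l(2) m(3) by (intro cong_mult)
    moreover have "[f h z = l h * 0] (mod int p)" unfolding f_def using m(2) H(3) by (intro cong_mult cong_refl) auto
    ultimately have "[1 * 1 = l h * 0] (mod int p)" using e by (meson cong_sym cong_trans)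
    then show False using p1 by (simp add: cong_def)
  qed
  ultimately show ?thesis using h by blast
qed

lemma cocycle_in_derived:
  assumes z: "z \<in> derived_sub" "z \<noteq> \<one>" and gen4: "generated_by_at_most G 4"
  shows "(\<exists>f. normalized_cocycle G (int p) f \<and> (\<exists>h\<in>carrier G. \<not> [f z h = f h z] (mod int p)))
    \<or> (extraspecial p G \<and> order G = p ^ 5)"
proof -
  have p1: "1 < int p" using prime_p prime_gt_1_nat by simp
  then have one: "\<not> [1 = 0] (mod int p)" by (simp add: cong_def)
  have zZ: "z \<in> Z" using z derived_subset_center by blast
  obtain f where f: "functional f" "[f z = 1] (mod int p)"
    using separating_functional[OF triv_subgroup Z_carrier[OF zZ]] z by (metis singletonD)
  have fz: "\<not> [f z = 0] (mod int p)" using f(2) one by (meson cong_sym cong_trans)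
  obtain n x e where "class_two_basis G p n x e" and n4: "n \<le> 4"
    and gen': "n = 4 \<longrightarrow> generate G (x ` {..<n}) = carrier G"
    using basis_exists[OF gen4] by blast
  then interpret class_two_basis G p n x e by blast
  \<comment> \<open>A form that vanishes on all pairs of basis elements is zero, against
    \<open>form_nonzero\<close>.\<close>
  have basis_pair: "\<exists>j<n. \<exists>k<n. \<not> [form f' (x j) (x k) = 0] (mod int p)"
    if f': "functional f'" and d: "d \<in> derived_sub" "\<not> [f' d = 0] (mod int p)" for f' d
  proof (rule ccontr)
    assume "\<not> ?thesis"
    then have 0: "[form f' (x j) (x k) = 0] (mod int p)" if "j < n" "k < n" for j k using that by blast
    have 1: "[form f' g (x k) = 0] (mod int p)" if "k < n" "g \<in> carrier G" for g k
      using zero_on_basis[of "\<lambda>g. form f' g (x k)" g] that 0 x_carrier form_character[OF f'] form_center[OF f']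
      by (simp add: kills_center_def)
    have "[form f' g h = 0] (mod int p)" if "g \<in> carrier G" "h \<in> carrier G" for g h
      using zero_on_basis[of "form f' g" h] that 1 form_character[OF f'] form_center[OF f']
      by (simp add: kills_center_def)
    then show False using form_nonzero[OF f' d] by blast
  qed
  have n2: "2 \<le> n"
  proof -
    \<comment> \<open>An alternating form needs two different basis elements in order to be
      nonzero.\<close>
    obtain j k where jk: "j < n" "k < n" "\<not> [form f (x j) (x k) = 0] (mod int p)"
      using basis_pair[OF f(1) z(1) fz] by blast
    then have "j \<noteq> k" using form_self[OF f(1) x_carrier] by auto
    then show ?thesis using jk(1,2) by linarith
  qed
  from wedge_dichotomy[OF f(1) n2 n4] show ?thesis
  proof (elim disjE exE conjE bexE)
    fix l g assume "character l" "kills_center l" "g \<in> carrier G" "\<not> [l g = 0] (mod int p)"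
      "\<forall>g\<in>carrier G. \<forall>h\<in>carrier G. \<forall>k\<in>carrier G. [wedge l (form f) g h k = 0] (mod int p)"
    then show ?thesis using decomposable_case[OF _ _ _ _ f(1) zZ fz, of l g] by blast
  next
    assume n_eq: "n = 4" and surj: "\<forall>s. alternating3 s \<longrightarrow> (\<exists>l. character l \<and> kills_center l \<and>
      (\<forall>g\<in>carrier G. \<forall>h\<in>carrier G. \<forall>k\<in>carrier G. [wedge l (form f) g h k = s g h k] (mod int p)))"
    let ?H = "generate G {z}"
    have H: "subgroup ?H G" using zZ by (intro generate_is_subgroup) simp
    show ?thesis
    proof (cases "derived_sub \<subseteq> ?H")
      case True
      \<comment> \<open>Four generators suffice and the basis has four elements, so the basis itself
        generates \<open>G\<close> and \<open>center_eq_derived\<close> applies.\<close>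
      have ZD: "Z = derived_sub" using center_eq_derived gen' n_eq by simp
      have cyc: "\<exists>k::int. c = z [^] k" if "c \<in> Z" for c
      proof -
        have "c \<in> ?H" using that True ZD by blast
        then show ?thesis using generate_pow[OF Z_carrier[OF zZ]] by auto
      qed
      have "card Z = p" "order G = p ^ 5" using order_if_center_cyclic[OF zZ z(2) cyc] n_eq by simp_all
      then show ?thesis using extraspecialI[OF ZD] by blast
    next
      case False
      then obtain d where d: "d \<in> derived_sub" "d \<notin> ?H" by blast
      have dc: "d \<in> carrier G" using d derived_subset_center by auto
      obtain f' where f': "functional f'" "\<And>h. h \<in> ?H \<Longrightarrow> [f' h = 0] (mod int p)" "[f' d = 1] (mod int p)"
        using separating_functional[OF H dc d(2)] by metis
      have f'z: "[f' z = 0] (mod int p)" by (intro f'(2) generate.incl) simp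
      have "\<not> [f' d = 0] (mod int p)" using f'(3) one by (meson cong_sym cong_trans)
      then obtain j k where jk: "j < n" "k < n" "\<not> [form f' (x j) (x k) = 0] (mod int p)"
        using basis_pair[OF f'(1) d(1)] by blast
      \<comment> \<open>A third index makes \<open>e i\<close> \<and> \<omega>' nonzero: at
        \<open>x i\<close>, \<open>x j\<close>, \<open>x k\<close> its value is that of \<omega>' at
        \<open>x j\<close>, \<open>x k\<close>. Hence the solution \<open>a\<close> of
        \<open>a\<close> \<and> \<omega> = \<open>e i\<close> \<and> \<omega>' found below is
        nonzero as well.\<close>
      obtain i where i: "i < n" "i \<noteq> j" "i \<noteq> k"
      proof -
        have "card {j, k} < card {..<n}" using n_eq by (simp add: card_insert_if)
        then have "\<not> {..<n} \<subseteq> {j, k}" by (meson card_mono finite.emptyI finite_insert leD)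
        then show thesis using that by blast
      qed
      obtain a where a: "character a" "kills_center a" and
        wa: "\<And>g h k. g \<in> carrier G \<Longrightarrow> h \<in> carrier G \<Longrightarrow> k \<in> carrier G \<Longrightarrow>
          [wedge a (form f) g h k = wedge (e i) (form f') g h k] (mod int p)"
        using surj alternating3_wedge[OF e_character[OF i(1)] e_center[OF i(1)] f'(1)] by meson
      have "\<exists>g\<in>carrier G. \<not> [a g = 0] (mod int p)"
      proof (rule ccontr)
        assume "\<not> ?thesis"
        then have a0: "[a g = 0] (mod int p)" if "g \<in> carrier G" for g using that by blast
        note xc = x_carrier[OF i(1)] x_carrier[OF jk(1)] x_carrier[OF jk(2)]
        have e: "[e i (x i) = 1] (mod int p)" "[e i (x j) = 0] (mod int p)" "[e i (x k) = 0] (mod int p)"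
          using dual[OF i(1) i(1)] dual[OF i(1) jk(1)] dual[OF i(1) jk(2)] i by simp_all
        have "[wedge a (form f) (x i) (x j) (x k)
            = 0 * form f (x j) (x k) + 0 * form f (x k) (x i) + 0 * form f (x i) (x j)] (mod int p)"
          unfolding wedge_def using xc by (intro cong_add cong_mult cong_refl a0)
        moreover have "[wedge (e i) (form f') (x i) (x j) (x k)
            = 1 * form f' (x j) (x k) + 0 * form f' (x k) (x i) + 0 * form f' (x i) (x j)] (mod int p)"
          unfolding wedge_def by (intro cong_add cong_mult cong_refl e)
        ultimately have "[1 * form f' (x j) (x k) + 0 * form f' (x k) (x i) + 0 * form f' (x i) (x j)
            = 0 * form f (x j) (x k) + 0 * form f (x k) (x i) + 0 * form f (x i) (x j)] (mod int p)"
          using wa[OF xc] by (meson cong_sym cong_trans)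
        then show False using jk(3) by simp
      qed
      then obtain g where g: "g \<in> carrier G" "\<not> [a g = 0] (mod int p)" by blast
      have "[e i (x i) = 1] (mod int p)" using dual[OF i(1) i(1)] by simp
      from pencil_case[OF a g e_character[OF i(1)] e_center[OF i(1)] x_carrier[OF i(1)] this f(1) f'(1) zZ f(2) f'z wa]
      show ?thesis by blast
    qed
  qed
qed

end

section \<open>The trichotomy\<close>

lemma class_two_groupI:
  fixes G (structure)
  assumes "Factorial_Ring.prime p" "odd p" "group G" "nilpotency_class_at_most G 2" "of_exponent G p"
  shows "class_two_group G p"
proof -
  interpret group G by fact
  have com: "commutator G x y \<in> center G" if x: "x \<in> carrier G" and y: "y \<in> carrier G" for x y
  proof -
    have D: "commutator G x y \<in> lower_central G 1"
      using x y by (auto simp: commutator_def intro!: generate.incl)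
    have "commutator G x y \<otimes> u = u \<otimes> commutator G x y" if u: "u \<in> carrier G" for u
    proof -
      have "commutator G (commutator G x y) u \<in> lower_central G (Suc 1)"
        unfolding commutator_def[of G "commutator G x y"] lower_central.simps(2)[of G 1]
        using D u by (intro generate.incl) blast
      then have "commutator G (commutator G x y) u = \<one>"
        using assms(4) by (simp add: nilpotency_class_at_most_def numeral_2_eq_2)
      then show ?thesis using x y u by (simp add: commutator_eq_one_iff)
    qed
    then show ?thesis using x y by (simp add: center_def)
  qed
  show ?thesis
    by unfold_locales (use assms com in \<open>auto simp: of_exponent_def\<close>)
qed

theorem theorem6p9:
  fixes G :: "('a, 'b) monoid_scheme" and p :: nat
  assumes "Factorial_Ring.prime p" and "odd p"
    and "group G"
    and "generated_by_at_most G 4"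
    and "nilpotency_class_at_most G 2"
    and "of_exponent G p"
  shows "((cyclic_group G \<and> \<not> trivial_group G)
            \<or> (extraspecial p G \<and> order G = p ^ 5 \<and> of_exponent G p)
            \<or> capable G)
       \<and> \<not> ((cyclic_group G \<and> \<not> trivial_group G)
            \<and> (extraspecial p G \<and> order G = p ^ 5 \<and> of_exponent G p))
       \<and> \<not> ((cyclic_group G \<and> \<not> trivial_group G) \<and> capable G)
       \<and> \<not> ((extraspecial p G \<and> order G = p ^ 5 \<and> of_exponent G p) \<and> capable G)"
proof -
  interpret class_two_group G p by (rule class_two_groupI) fact+
  have p0: "0 < int p" using prime_p prime_gt_0_nat by simp
  have "capable G" if nc: "\<not> (cyclic_group G \<and> \<not> trivial_group G)"
    and ne: "\<not> (extraspecial p G \<and> order G = p ^ 5)"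
  \<comment> \<open>For the trivial group there is no such \<open>z\<close>, and capability follows
    vacuously; otherwise the first hypothesis says that \<open>G\<close> is not cyclic.\<close>
  proof (rule capable_if_cocycles[OF assms(3) p0])
    fix z assume z: "z \<in> center G" "z \<noteq> \<one>\<^bsub>G\<^esub>"
    then have "\<not> trivial_group G"
      using Z_carrier[OF z(1)] unfolding trivial_group_def by (metis singletonD)
    then show "\<exists>f. normalized_cocycle G (int p) f \<and> (\<exists>h\<in>carrier G. \<not> [f z h = f h z] (mod int p))"
      using cocycle_outside_derived[OF z(1)] cocycle_in_derived[OF _ z(2) assms(4)] nc ne by blast
  qed
  \<comment> \<open>A cyclic group is its own center, so its central quotient is trivial, which
    \<open>extraspecial\<close> excludes.\<close>
  moreover have "\<not> cyclic_group G" if es: "extraspecial p G"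
  proof
    assume "cyclic_group G"
    then interpret comm_group G by (rule cyclic_imp_abelian_group)
    have "center G = carrier G" unfolding center_def using m_comm by blast
    moreover have "trivial_group (G Mod carrier G)"
    proof -
      have "carrier (G Mod carrier G) = {carrier G}"
        using coset_join2[OF _ subgroup_self] one_closed unfolding carrier_FactGroup by blast
      then show ?thesis
        using normal.factorgroup_is_group[OF normal_self] by (simp add: trivial_group_def)
    qed
    ultimately show False using es by (simp add: extraspecial_def)
  qed
  ultimately show ?thesis
    using cyclic_not_capable[OF assms(3)] extraspecial_p5_not_capable[OF assms(1)] assms(6) by blast
qed

end
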